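(* Let $\mathcal D$ be a square in $\mathrm{Cat}$, given by functors $v:A'\to A$, $w:B'\to B$, $u':A'\to B'$, $u:A\to B$ between small categories and a natural transformation $\alpha:uv\to wu'$, such that $u$ and $u'$ admit right adjoints. Then the following conditions are equivalent: (a) $\mathcal D$ is a left Beck–Chevalley square; (b) $\mathcal D$ is $\mathcal W_\infty$-exact; (c) $\mathcal D$ is $\mathcal W_0$-exact; (d) for every object $a$ of $A$, the functor $a\backslash A'\to u(a)\backslash B'$ induced by $u'$ admits a right adjoint; (e) for every object $a$ of $A$, every object $b'$ of $B'$ and every arrow $g:u(a)\to w(b')$ of $B$, the category $A'_{(a,b',g)}$ has a terminal object.
   Context: $\mathrm{Cat}$ is the 2-category of small categories; $e$ is the terminal category. Left Beck–Chevalley: let $r,r'$ be right adjoints of $u,u'$, with unit $\eta:1_A\to ru$ of the first adjunction and counit $\varepsilon':u'r'\to 1_{B'}$ of the second. $\mathcal D$ is a left Beck–Chevalley square if $u$ and $u'$ have right adjoints and the base change morphism $c=(rw\star\varepsilon')(r\star\alpha\star r')(\eta\star vr'):vr'\to rw$ is an isomorphism (independent of the choice of adjoints and of adjunction morphisms). For a functor $p:X\to Y$ and an object $y$ of $Y$, $y\backslash X$ is the category of pairs $(x,\,y\to p(x))$, with the evident morphisms; here $a\backslash A'$ is formed with respect to $v$ and $u(a)\backslash B'$ with respect to $w$. The functor $a\backslash A'\to u(a)\backslash B'$ induced by $u'$ sends $(a',f:a\to v(a'))$ to $(u'(a'),\alpha_{a'}u(f):u(a)\to wu'(a'))$ and an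 arrow $f'$ to $u'(f')$. For $a\in\mathrm{Ob}\,A$, $b'\in\mathrm{Ob}\,B'$ and $g:u(a)\to w(b')$ in $B$, $A'_{(a,b',g)}$ is the category whose objects are triples $(a',f,g')$ with $a'\in\mathrm{Ob}\,A'$, $f:a\to v(a')$ in $A$, $g':u'(a')\to b'$ in $B'$ such that $w(g')\alpha_{a'}u(f)=g$; morphisms $(a'_1,f_1,g'_1)\to(a'_2,f_2,g'_2)$ are arrows $f':a'_1\to a'_2$ of $A'$ with $v(f')f_1=f_2$ and $g'_2u'(f')=g'_1$. $\mathcal W_\infty$ is the class of functors between small categories whose nerve is a weak homotopy equivalence of simplicial sets; $\mathcal W_0$ is the class of functors inducing a bijection on sets of connected components. For $\mathcal W\in\{\mathcal W_\infty,\mathcal W_0\}$, a small category $C$ is $\mathcal W$-aspherical if $C\to e$ is in $\mathcal W$, and $\mathcal D$ is $\mathcal W$-exact if all the categories $A'_{(a,b',g)}$ are $\mathcal W$-aspherical. *)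

theory Defs
  imports "HOL-Homology.Homology"
begin

section \<open>Categories, functors and natural transformations\<close>

text \<open>
  The objects and the arrows of a category form sets in HOL, so every category below is small.
  \<open>Comp C g f\<close> is the composite \<open>g \<circ> f\<close>; only its values on composable pairs of arrows matter.
\<close>

record ('o, 'm) cat =
  Ob :: "'o set"
  Ar :: "'m set"
  Dom :: "'m \<Rightarrow> 'o"
  Cod :: "'m \<Rightarrow> 'o"
  Ide :: "'o \<Rightarrow> 'm"
  Comp :: "'m \<Rightarrow> 'm \<Rightarrow> 'm"

definition Hom :: "('o, 'm) cat \<Rightarrow> 'o \<Rightarrow> 'o \<Rightarrow> 'm set" where
  "Hom C x y = {f \<in> Ar C. Dom C f = x \<and> Cod C f = y}"

locale category =
  fixes C :: "('o, 'm) cat"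
  assumes dom_in: "f \<in> Ar C \<Longrightarrow> Dom C f \<in> Ob C"
    and cod_in: "f \<in> Ar C \<Longrightarrow> Cod C f \<in> Ob C"
    and ide_in: "x \<in> Ob C \<Longrightarrow> Ide C x \<in> Hom C x x"
    and comp_in: "\<lbrakk>f \<in> Hom C x y; g \<in> Hom C y z\<rbrakk> \<Longrightarrow> Comp C g f \<in> Hom C x z"
    and comp_ide_left: "f \<in> Hom C x y \<Longrightarrow> Comp C (Ide C y) f = f"
    and comp_ide_right: "f \<in> Hom C x y \<Longrightarrow> Comp C f (Ide C x) = f"
    and comp_assoc: "\<lbrakk>f \<in> Hom C x y; g \<in> Hom C y z; h \<in> Hom C z t\<rbrakk>
      \<Longrightarrow> Comp C h (Comp C g f) = Comp C (Comp C h g) f"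

text \<open>
  The values of a functor outside the objects and arrows of its source are irrelevant;
  this is also why natural transformations are only compared on objects of the source.
\<close>

record ('o, 'm, 'p, 'n) cfun =
  FOb :: "'o \<Rightarrow> 'p"
  FAr :: "'m \<Rightarrow> 'n"

locale cat_functor = source: category C + target: category D
  for C :: "('o, 'm) cat" and D :: "('p, 'n) cat" +
  fixes F :: "('o, 'm, 'p, 'n) cfun"
  assumes ob_in: "x \<in> Ob C \<Longrightarrow> FOb F x \<in> Ob D"
    and ar_in: "f \<in> Hom C x y \<Longrightarrow> FAr F f \<in> Hom D (FOb F x) (FOb F y)"
    and map_ide: "x \<in> Ob C \<Longrightarrow> FAr F (Ide C x) = Ide D (FOb F x)"
    and map_comp: "\<lbrakk>f \<in> Hom C x y; g \<in> Hom C y z\<rbrakk>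
      \<Longrightarrow> FAr F (Comp C g f) = Comp D (FAr F g) (FAr F f)"

definition id_fun :: "('o, 'm, 'o, 'm) cfun" where
  "id_fun = \<lparr>FOb = \<lambda>x. x, FAr = \<lambda>f. f\<rparr>"

definition comp_fun :: "('p, 'n, 'q, 'k) cfun \<Rightarrow> ('o, 'm, 'p, 'n) cfun \<Rightarrow> ('o, 'm, 'q, 'k) cfun"
    (infixl "\<cdot>\<^sub>F" 70) where
  "G \<cdot>\<^sub>F F = \<lparr>FOb = \<lambda>x. FOb G (FOb F x), FAr = \<lambda>f. FAr G (FAr F f)\<rparr>"

locale nat_trans = source: cat_functor C D F + target: cat_functor C D G
  for C :: "('o, 'm) cat" and D :: "('p, 'n) cat"
    and F :: "('o, 'm, 'p, 'n) cfun" and G :: "('o, 'm, 'p, 'n) cfun" +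
  fixes \<tau> :: "'o \<Rightarrow> 'n"
  assumes component_in: "x \<in> Ob C \<Longrightarrow> \<tau> x \<in> Hom D (FOb F x) (FOb G x)"
    and naturality: "f \<in> Hom C x y \<Longrightarrow> Comp D (\<tau> y) (FAr F f) = Comp D (FAr G f) (\<tau> x)"

definition id_nat :: "('p, 'n) cat \<Rightarrow> ('o, 'm, 'p, 'n) cfun \<Rightarrow> 'o \<Rightarrow> 'n" where
  "id_nat D F = (\<lambda>x. Ide D (FOb F x))"

definition vcomp :: "('p, 'n) cat \<Rightarrow> ('o \<Rightarrow> 'n) \<Rightarrow> ('o \<Rightarrow> 'n) \<Rightarrow> 'o \<Rightarrow> 'n" where
  "vcomp D \<sigma> \<tau> = (\<lambda>x. Comp D (\<sigma> x) (\<tau> x))"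

definition whisker_l :: "('p, 'n, 'q, 'k) cfun \<Rightarrow> ('o \<Rightarrow> 'n) \<Rightarrow> 'o \<Rightarrow> 'k" where
  "whisker_l H \<tau> = (\<lambda>x. FAr H (\<tau> x))"

definition whisker_r :: "('p \<Rightarrow> 'k) \<Rightarrow> ('o, 'm, 'p, 'n) cfun \<Rightarrow> 'o \<Rightarrow> 'k" where
  "whisker_r \<tau> K = (\<lambda>x. \<tau> (FOb K x))"

definition nat_iso :: "('o, 'm) cat \<Rightarrow> ('p, 'n) cat \<Rightarrow> ('o, 'm, 'p, 'n) cfun \<Rightarrow>
    ('o, 'm, 'p, 'n) cfun \<Rightarrow> ('o \<Rightarrow> 'n) \<Rightarrow> bool" where
  "nat_iso C D F G \<tau> \<longleftrightarrow> nat_trans C D F G \<tau> \<and>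
     (\<exists>\<sigma>. nat_trans C D G F \<sigma> \<and>
        (\<forall>x\<in>Ob C. vcomp D \<sigma> \<tau> x = id_nat D F x) \<and>
        (\<forall>x\<in>Ob C. vcomp D \<tau> \<sigma> x = id_nat D G x))"

definition has_terminal_object :: "('o, 'm) cat \<Rightarrow> bool" where
  "has_terminal_object C \<longleftrightarrow> (\<exists>t\<in>Ob C. \<forall>x\<in>Ob C. \<exists>!f. f \<in> Hom C x t)"


section \<open>Adjunctions\<close>

text \<open>\<open>F : C \<rightarrow> D\<close> is left adjoint to \<open>G : D \<rightarrow> C\<close>, with unit \<open>\<eta>\<close> and counit \<open>\<epsilon>\<close>.\<close>

definition adjunction :: "('o, 'm) cat \<Rightarrow> ('p, 'n) cat \<Rightarrow> ('o, 'm, 'p, 'n) cfun \<Rightarrow>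
    ('p, 'n, 'o, 'm) cfun \<Rightarrow> ('o \<Rightarrow> 'm) \<Rightarrow> ('p \<Rightarrow> 'n) \<Rightarrow> bool" where
  "adjunction C D F G \<eta> \<epsilon> \<longleftrightarrow>
     cat_functor C D F \<and> cat_functor D C G \<and>
     nat_trans C C id_fun (G \<cdot>\<^sub>F F) \<eta> \<and> nat_trans D D (F \<cdot>\<^sub>F G) id_fun \<epsilon> \<and>
     (\<forall>x\<in>Ob C. vcomp D (whisker_r \<epsilon> F) (whisker_l F \<eta>) x = id_nat D F x) \<and>
     (\<forall>y\<in>Ob D. vcomp C (whisker_l G \<epsilon>) (whisker_r \<eta> G) y = id_nat C G y)"

definition has_right_adjoint :: "('o, 'm) cat \<Rightarrow> ('p, 'n) cat \<Rightarrow> ('o, 'm, 'p, 'n) cfun \<Rightarrow> bool" where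
  "has_right_adjoint C D F \<longleftrightarrow> (\<exists>G \<eta> \<epsilon>. adjunction C D F G \<eta> \<epsilon>)"


section \<open>Squares and the left Beck--Chevalley condition\<close>

text \<open>
  A square consists of functors \<open>v : A' \<rightarrow> A\<close>, \<open>w : B' \<rightarrow> B\<close>, \<open>u' : A' \<rightarrow> B'\<close>, \<open>u : A \<rightarrow> B\<close>
  and a 2-cell \<open>\<alpha> : u v \<rightarrow> w u'\<close>.
\<close>

locale cat_square =
  A: category A + B: category B + A': category A' + B': category B' +
  v: cat_functor A' A v + w: cat_functor B' B w +
  u': cat_functor A' B' u' + u: cat_functor A B u +
  \<alpha>: nat_trans A' B "u \<cdot>\<^sub>F v" "w \<cdot>\<^sub>F u'" \<alpha>
  for A :: "('a, 'am) cat" and B :: "('b, 'bm) cat"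
    and A' :: "('c, 'cm) cat" and B' :: "('d, 'dm) cat"
    and v :: "('c, 'cm, 'a, 'am) cfun" and w :: "('d, 'dm, 'b, 'bm) cfun"
    and u' :: "('c, 'cm, 'd, 'dm) cfun" and u :: "('a, 'am, 'b, 'bm) cfun"
    and \<alpha> :: "'c \<Rightarrow> 'bm"

definition base_change :: "('a, 'am) cat \<Rightarrow> ('c, 'cm, 'a, 'am) cfun \<Rightarrow> ('d, 'dm, 'b, 'bm) cfun \<Rightarrow>
    ('c \<Rightarrow> 'bm) \<Rightarrow> ('b, 'bm, 'a, 'am) cfun \<Rightarrow> ('d, 'dm, 'c, 'cm) cfun \<Rightarrow>
    ('a \<Rightarrow> 'am) \<Rightarrow> ('d \<Rightarrow> 'dm) \<Rightarrow> 'd \<Rightarrow> 'am" where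
  "base_change A v w \<alpha> r r' \<eta> \<epsilon>' =
     vcomp A (whisker_l (r \<cdot>\<^sub>F w) \<epsilon>')
       (vcomp A (whisker_r (whisker_l r \<alpha>) r') (whisker_r \<eta> (v \<cdot>\<^sub>F r')))"

text \<open>
  The base change morphism is an isomorphism for one choice of the adjunctions if and only if
  it is one for all choices.
\<close>

definition left_beck_chevalley :: "('a, 'am) cat \<Rightarrow> ('b, 'bm) cat \<Rightarrow> ('c, 'cm) cat \<Rightarrow> ('d, 'dm) cat \<Rightarrow>
    ('c, 'cm, 'a, 'am) cfun \<Rightarrow> ('d, 'dm, 'b, 'bm) cfun \<Rightarrow> ('c, 'cm, 'd, 'dm) cfun \<Rightarrow>
    ('a, 'am, 'b, 'bm) cfun \<Rightarrow> ('c \<Rightarrow> 'bm) \<Rightarrow> bool" where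
  "left_beck_chevalley A B A' B' v w u' u \<alpha> \<longleftrightarrow>
     (\<exists>r \<eta> \<epsilon> r' \<eta>' \<epsilon>'. adjunction A B u r \<eta> \<epsilon> \<and> adjunction A' B' u' r' \<eta>' \<epsilon>' \<and>
        nat_iso B' A (v \<cdot>\<^sub>F r') (r \<cdot>\<^sub>F w) (base_change A v w \<alpha> r r' \<eta> \<epsilon>'))"


section \<open>The categories attached to a square\<close>

text \<open>
  \<open>under_cat X Y p y\<close> is the category of pairs \<open>(x, y \<rightarrow> p x)\<close>. Since one arrow of \<open>X\<close> may
  underlie arrows between different pairs, an arrow is recorded as (source, arrow of \<open>X\<close>, target).
\<close>

definition under_cat :: "('o, 'm) cat \<Rightarrow> ('p, 'n) cat \<Rightarrow> ('o, 'm, 'p, 'n) cfun \<Rightarrow> 'p \<Rightarrow>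
    ('o \<times> 'n, ('o \<times> 'n) \<times> 'm \<times> ('o \<times> 'n)) cat" where
  "under_cat X Y p y =
    (let obs = {(x, k). x \<in> Ob X \<and> k \<in> Hom Y y (FOb p x)} in
     \<lparr>Ob = obs,
      Ar = {((x, k), h, (x', k')) | x k h x' k'. (x, k) \<in> obs \<and> (x', k') \<in> obs \<and>
              h \<in> Hom X x x' \<and> Comp Y (FAr p h) k = k'},
      Dom = (\<lambda>(s, h, t). s),
      Cod = (\<lambda>(s, h, t). t),
      Ide = (\<lambda>s. (s, Ide X (fst s), s)),
      Comp = (\<lambda>(s', h', t') (s, h, t). (s, Comp X h' h, t'))\<rparr>)"

definition under_functor :: "('b, 'bm) cat \<Rightarrow> ('c, 'cm, 'd, 'dm) cfun \<Rightarrow>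
    ('a, 'am, 'b, 'bm) cfun \<Rightarrow> ('c \<Rightarrow> 'bm) \<Rightarrow>
    ('c \<times> 'am, ('c \<times> 'am) \<times> 'cm \<times> ('c \<times> 'am), 'd \<times> 'bm, ('d \<times> 'bm) \<times> 'dm \<times> ('d \<times> 'bm)) cfun" where
  "under_functor B u' u \<alpha> =
    (let onob = (\<lambda>(a', f). (FOb u' a', Comp B (\<alpha> a') (FAr u f))) in
     \<lparr>FOb = onob, FAr = (\<lambda>(s, f', t). (onob s, FAr u' f', onob t))\<rparr>)"

text \<open>The same convention for arrows is used for the category of triples \<open>(a', f, g')\<close> over \<open>(a, b', g)\<close>.\<close>

definition fibre_cat :: "('a, 'am) cat \<Rightarrow> ('b, 'bm) cat \<Rightarrow> ('c, 'cm) cat \<Rightarrow> ('d, 'dm) cat \<Rightarrow>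
    ('c, 'cm, 'a, 'am) cfun \<Rightarrow> ('d, 'dm, 'b, 'bm) cfun \<Rightarrow> ('c, 'cm, 'd, 'dm) cfun \<Rightarrow>
    ('a, 'am, 'b, 'bm) cfun \<Rightarrow> ('c \<Rightarrow> 'bm) \<Rightarrow> 'a \<Rightarrow> 'd \<Rightarrow> 'bm \<Rightarrow>
    ('c \<times> 'am \<times> 'dm, ('c \<times> 'am \<times> 'dm) \<times> 'cm \<times> ('c \<times> 'am \<times> 'dm)) cat" where
  "fibre_cat A B A' B' v w u' u \<alpha> a b' g =
    (let obs = {(a', f, g'). a' \<in> Ob A' \<and> f \<in> Hom A a (FOb v a') \<and> g' \<in> Hom B' (FOb u' a') b' \<and>
                  Comp B (FAr w g') (Comp B (\<alpha> a') (FAr u f)) = g} in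
     \<lparr>Ob = obs,
      Ar = {((a1, f1, g1), f', (a2, f2, g2)) | a1 f1 g1 f' a2 f2 g2.
              (a1, f1, g1) \<in> obs \<and> (a2, f2, g2) \<in> obs \<and> f' \<in> Hom A' a1 a2 \<and>
              Comp A (FAr v f') f1 = f2 \<and> Comp B' g2 (FAr u' f') = g1},
      Dom = (\<lambda>(s, h, t). s),
      Cod = (\<lambda>(s, h, t). t),
      Ide = (\<lambda>s. (s, Ide A' (fst s), s)),
      Comp = (\<lambda>(s', h', t') (s, h, t). (s, Comp A' h' h, t'))\<rparr>)"

lemma Ob_under_cat: "Ob (under_cat X Y p y) = {(x, k). x \<in> Ob X \<and> k \<in> Hom Y y (FOb p x)}"
  by (simp add: under_cat_def Let_def)

lemma Ar_under_cat:
  "f \<in> Ar (under_cat X Y p y) \<longleftrightarrow> f \<in> Hom (under_cat X Y p y) (fst f) (snd (snd f))"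
  by (auto simp: under_cat_def Let_def Hom_def)

lemma Hom_under_cat:
  "Hom (under_cat X Y p y) s t =
     {(s, h, t) | h. s \<in> Ob (under_cat X Y p y) \<and> t \<in> Ob (under_cat X Y p y) \<and>
        h \<in> Hom X (fst s) (fst t) \<and> Comp Y (FAr p h) (snd s) = snd t}"
  by (cases s; cases t) (auto simp: under_cat_def Let_def Hom_def)

lemma under_cat_simps:
  "Dom (under_cat X Y p y) (s, h, t) = s"
  "Cod (under_cat X Y p y) (s, h, t) = t"
  "Ide (under_cat X Y p y) s = (s, Ide X (fst s), s)"
  "Comp (under_cat X Y p y) (s', h', t') (s, h, t) = (s, Comp X h' h, t')"
  by (simp_all add: under_cat_def Let_def)

lemma category_under_cat:
  assumes "cat_functor X Y p"
  shows "category (under_cat X Y p y)"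
proof -
  interpret cat_functor X Y p by fact
  show ?thesis
  proof
    fix s assume "s \<in> Ob (under_cat X Y p y)"
    then show "Ide (under_cat X Y p y) s \<in> Hom (under_cat X Y p y) s s"
      by (auto simp: Hom_under_cat under_cat_simps Ob_under_cat map_ide
          intro: source.ide_in target.comp_ide_left)
  next
    fix f g s t r
    assume f: "f \<in> Hom (under_cat X Y p y) s t" and g: "g \<in> Hom (under_cat X Y p y) t r"
    obtain h where h: "f = (s, h, t)" "s \<in> Ob (under_cat X Y p y)" "h \<in> Hom X (fst s) (fst t)"
      "Comp Y (FAr p h) (snd s) = snd t"
      using f by (auto simp: Hom_under_cat)
    obtain k where k: "g = (t, k, r)" "r \<in> Ob (under_cat X Y p y)" "k \<in> Hom X (fst t) (fst r)"
      "Comp Y (FAr p k) (snd t) = snd r"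
      using g by (auto simp: Hom_under_cat)
    have s: "snd s \<in> Hom Y y (FOb p (fst s))"
      using h(2) by (auto simp: Ob_under_cat)
    have "Comp Y (FAr p (Comp X k h)) (snd s) = snd r"
      using target.comp_assoc[OF s ar_in[OF h(3)] ar_in[OF k(3)]] h(4) k(4)
      by (simp add: map_comp[OF h(3) k(3)])
    then show "Comp (under_cat X Y p y) g f \<in> Hom (under_cat X Y p y) s r"
      using h k source.comp_in[OF h(3) k(3)] by (simp add: Hom_under_cat under_cat_simps)
  qed (auto simp: Ar_under_cat Hom_under_cat under_cat_simps
      intro: source.comp_ide_left source.comp_ide_right source.comp_assoc)
qed

lemma Ob_fibre_cat:
  "Ob (fibre_cat A B A' B' v w u' u \<alpha> a b' g) =
     {(a', f, g'). a' \<in> Ob A' \<and> f \<in> Hom A a (FOb v a') \<and> g' \<in> Hom B' (FOb u' a') b' \<and>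
        Comp B (FAr w g') (Comp B (\<alpha> a') (FAr u f)) = g}"
  by (simp add: fibre_cat_def Let_def)

lemma Ar_fibre_cat:
  "f \<in> Ar (fibre_cat A B A' B' v w u' u \<alpha> a b' g) \<longleftrightarrow>
     f \<in> Hom (fibre_cat A B A' B' v w u' u \<alpha> a b' g) (fst f) (snd (snd f))"
  by (auto simp: fibre_cat_def Let_def Hom_def)

lemma Hom_fibre_cat:
  "Hom (fibre_cat A B A' B' v w u' u \<alpha> a b' g) s t =
     {(s, h, t) | h. s \<in> Ob (fibre_cat A B A' B' v w u' u \<alpha> a b' g) \<and>
        t \<in> Ob (fibre_cat A B A' B' v w u' u \<alpha> a b' g) \<and> h \<in> Hom A' (fst s) (fst t) \<and>
        Comp A (FAr v h) (fst (snd s)) = fst (snd t) \<and>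
        Comp B' (snd (snd t)) (FAr u' h) = snd (snd s)}"
  by (cases s; cases t) (auto simp: fibre_cat_def Let_def Hom_def)

lemma fibre_cat_simps:
  "Dom (fibre_cat A B A' B' v w u' u \<alpha> a b' g) (s, h, t) = s"
  "Cod (fibre_cat A B A' B' v w u' u \<alpha> a b' g) (s, h, t) = t"
  "Ide (fibre_cat A B A' B' v w u' u \<alpha> a b' g) s = (s, Ide A' (fst s), s)"
  "Comp (fibre_cat A B A' B' v w u' u \<alpha> a b' g) (s', h', t') (s, h, t) = (s, Comp A' h' h, t')"
  by (simp_all add: fibre_cat_def Let_def)

context cat_square
begin

lemma component_under:
  assumes "a' \<in> Ob A'" "f \<in> Hom A a (FOb v a')"
  shows "Comp B (\<alpha> a') (FAr u f) \<in> Hom B (FOb u a) (FOb w (FOb u' a'))"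
  using \<alpha>.component_in[OF assms(1)] u.ar_in[OF assms(2)] B.comp_in
  by (auto simp: comp_fun_def)

lemma component_natural:
  assumes f: "f \<in> Hom A a (FOb v x)" and h: "h \<in> Hom A' x y"
  shows "Comp B (\<alpha> y) (FAr u (Comp A (FAr v h) f)) =
         Comp B (FAr w (FAr u' h)) (Comp B (\<alpha> x) (FAr u f))"
proof -
  have x: "x \<in> Ob A'" and y: "y \<in> Ob A'"
    using h A'.dom_in A'.cod_in by (auto simp: Hom_def)
  have vh: "FAr v h \<in> Hom A (FOb v x) (FOb v y)"
    by (rule v.ar_in[OF h])
  have "Comp B (\<alpha> y) (FAr u (Comp A (FAr v h) f)) =
        Comp B (\<alpha> y) (Comp B (FAr u (FAr v h)) (FAr u f))"
    by (simp add: u.map_comp[OF f vh])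
  also have "\<dots> = Comp B (Comp B (\<alpha> y) (FAr u (FAr v h))) (FAr u f)"
    using B.comp_assoc[OF u.ar_in[OF f] u.ar_in[OF vh]] \<alpha>.component_in[OF y]
    by (simp add: comp_fun_def)
  also have "\<dots> = Comp B (Comp B (FAr w (FAr u' h)) (\<alpha> x)) (FAr u f)"
    using \<alpha>.naturality[OF h] by (simp add: comp_fun_def)
  also have "\<dots> = Comp B (FAr w (FAr u' h)) (Comp B (\<alpha> x) (FAr u f))"
    using B.comp_assoc[OF u.ar_in[OF f], of "\<alpha> x" _ "FAr w (FAr u' h)"]
      \<alpha>.component_in[OF x] w.ar_in[OF u'.ar_in[OF h]]
    by (simp add: comp_fun_def)
  finally show ?thesis .
qed

lemma under_functor_ob_in:
  assumes "s \<in> Ob (under_cat A' A v a)"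
  shows "FOb (under_functor B u' u \<alpha>) s \<in> Ob (under_cat B' B w (FOb u a))"
  using assms component_under u'.ob_in
  by (auto simp: Ob_under_cat under_functor_def Let_def)

lemma cat_functor_under_functor:
  "cat_functor (under_cat A' A v a) (under_cat B' B w (FOb u a)) (under_functor B u' u \<alpha>)"
proof -
  interpret S: category "under_cat A' A v a"
    using category_under_cat[OF v.cat_functor_axioms] .
  interpret T: category "under_cat B' B w (FOb u a)"
    using category_under_cat[OF w.cat_functor_axioms] .
  show ?thesis
  proof
    fix k s t
    assume "k \<in> Hom (under_cat A' A v a) s t"
    then obtain x f y f' h where k: "s = (x, f)" "t = (y, f')" "k = (s, h, t)"
      and st: "s \<in> Ob (under_cat A' A v a)" "t \<in> Ob (under_cat A' A v a)"
      and h: "h \<in> Hom A' x y" and f': "Comp A (FAr v h) f = f'"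
      by (cases s; cases t) (auto simp: Hom_under_cat)
    have "f \<in> Hom A a (FOb v x)"
      using st k by (simp add: Ob_under_cat)
    then have "Comp B (FAr w (FAr u' h)) (Comp B (\<alpha> x) (FAr u f)) = Comp B (\<alpha> y) (FAr u f')"
      using component_natural h f' by metis
    then show "FAr (under_functor B u' u \<alpha>) k \<in> Hom (under_cat B' B w (FOb u a))
        (FOb (under_functor B u' u \<alpha>) s) (FOb (under_functor B u' u \<alpha>) t)"
      using k under_functor_ob_in[OF st(1)] under_functor_ob_in[OF st(2)] u'.ar_in[OF h]
      by (simp add: Hom_under_cat under_functor_def Let_def)
  next
    fix s assume "s \<in> Ob (under_cat A' A v a)"
    then show "FAr (under_functor B u' u \<alpha>) (Ide (under_cat A' A v a) s) =
        Ide (under_cat B' B w (FOb u a)) (FOb (under_functor B u' u \<alpha>) s)"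
      by (auto simp: Ob_under_cat under_cat_simps under_functor_def Let_def u'.map_ide)
  next
    fix f g s t r
    assume "f \<in> Hom (under_cat A' A v a) s t" "g \<in> Hom (under_cat A' A v a) t r"
    then show "FAr (under_functor B u' u \<alpha>) (Comp (under_cat A' A v a) g f) =
        Comp (under_cat B' B w (FOb u a)) (FAr (under_functor B u' u \<alpha>) g)
          (FAr (under_functor B u' u \<alpha>) f)"
      by (auto simp: Hom_under_cat under_cat_simps under_functor_def Let_def intro: u'.map_comp)
  qed (rule under_functor_ob_in)
qed

lemma category_fibre_cat: "category (fibre_cat A B A' B' v w u' u \<alpha> a b' g)"
    (is "category ?F")
proof
  fix s assume "s \<in> Ob ?F"
  then show "Ide ?F s \<in> Hom ?F s s"
    by (auto simp: Hom_fibre_cat fibre_cat_simps Ob_fibre_cat v.map_ide u'.map_ide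
        intro: A'.ide_in A.comp_ide_left B'.comp_ide_right)
next
  fix f g s t r
  assume f: "f \<in> Hom ?F s t" and g: "g \<in> Hom ?F t r"
  obtain h where h: "f = (s, h, t)" "s \<in> Ob ?F" "h \<in> Hom A' (fst s) (fst t)"
    "Comp A (FAr v h) (fst (snd s)) = fst (snd t)"
    "Comp B' (snd (snd t)) (FAr u' h) = snd (snd s)"
    using f by (auto simp: Hom_fibre_cat)
  obtain k where k: "g = (t, k, r)" "r \<in> Ob ?F" "k \<in> Hom A' (fst t) (fst r)"
    "Comp A (FAr v k) (fst (snd t)) = fst (snd r)"
    "Comp B' (snd (snd r)) (FAr u' k) = snd (snd t)"
    using g by (auto simp: Hom_fibre_cat)
  have s: "fst (snd s) \<in> Hom A a (FOb v (fst s))"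
    using h(2) by (auto simp: Ob_fibre_cat)
  have r: "snd (snd r) \<in> Hom B' (FOb u' (fst r)) b'"
    using k(2) by (auto simp: Ob_fibre_cat)
  have "Comp A (FAr v (Comp A' k h)) (fst (snd s)) = fst (snd r)"
    using A.comp_assoc[OF s v.ar_in[OF h(3)] v.ar_in[OF k(3)]] h(4) k(4)
    by (simp add: v.map_comp[OF h(3) k(3)])
  moreover have "Comp B' (snd (snd r)) (FAr u' (Comp A' k h)) = snd (snd s)"
    using B'.comp_assoc[OF u'.ar_in[OF h(3)] u'.ar_in[OF k(3)] r] h(5) k(5)
    by (simp add: u'.map_comp[OF h(3) k(3)])
  ultimately show "Comp ?F g f \<in> Hom ?F s r"
    using h k A'.comp_in[OF h(3) k(3)] by (simp add: Hom_fibre_cat fibre_cat_simps)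
qed (auto simp: Ar_fibre_cat Hom_fibre_cat fibre_cat_simps
    intro: A'.comp_ide_left A'.comp_ide_right A'.comp_assoc)

end


section \<open>Simplicial sets and the nerve\<close>

text \<open>
  \<open>Act X m n \<theta> : X\<^sub>n \<rightarrow> X\<^sub>m\<close> is the operator attached to a monotone map
  \<open>\<theta> : {0,\<dots>,m} \<rightarrow> {0,\<dots>,n}\<close>.
\<close>

record 'x sset =
  Smp :: "nat \<Rightarrow> 'x set"
  Act :: "nat \<Rightarrow> nat \<Rightarrow> (nat \<Rightarrow> nat) \<Rightarrow> 'x \<Rightarrow> 'x"

definition mono_maps :: "nat \<Rightarrow> nat \<Rightarrow> (nat \<Rightarrow> nat) set" where
  "mono_maps m n = {\<theta> \<in> {..m} \<rightarrow>\<^sub>E {..n}. mono_on {..m} \<theta>}"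

locale simplicial_set =
  fixes X :: "'x sset"
  assumes act_in: "\<lbrakk>\<theta> \<in> mono_maps m n; x \<in> Smp X n\<rbrakk> \<Longrightarrow> Act X m n \<theta> x \<in> Smp X m"
    and act_id: "x \<in> Smp X n \<Longrightarrow> Act X n n (restrict id {..n}) x = x"
    and act_comp: "\<lbrakk>\<theta> \<in> mono_maps l m; \<phi> \<in> mono_maps m n; x \<in> Smp X n\<rbrakk>
      \<Longrightarrow> Act X l m \<theta> (Act X m n \<phi> x) = Act X l n (compose {..l} \<phi> \<theta>) x"

definition ordinal_cat :: "nat \<Rightarrow> (nat, nat \<times> nat) cat" where
  "ordinal_cat n =
    \<lparr>Ob = {..n}, Ar = {(i, j). i \<le> j \<and> j \<le> n}, Dom = fst, Cod = snd,
     Ide = (\<lambda>i. (i, i)), Comp = (\<lambda>q p. (fst p, snd q))\<rparr>"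

definition ordinal_functor :: "(nat \<Rightarrow> nat) \<Rightarrow> (nat, nat \<times> nat, nat, nat \<times> nat) cfun" where
  "ordinal_functor \<theta> = \<lparr>FOb = \<theta>, FAr = map_prod \<theta> \<theta>\<rparr>"

definition restrict_fun :: "('o, 'm) cat \<Rightarrow> ('o, 'm, 'p, 'n) cfun \<Rightarrow> ('o, 'm, 'p, 'n) cfun" where
  "restrict_fun C F = \<lparr>FOb = restrict (FOb F) (Ob C), FAr = restrict (FAr F) (Ar C)\<rparr>"

text \<open>
  The \<open>n\<close>-simplices of the nerve are the functors \<open>[n] \<rightarrow> C\<close>. Requiring \<open>restrict_fun\<close> to fix them
  makes equality of simplices the same as equality of functors.
\<close>

type_synonym ('o, 'm) nerve_simplex = "(nat, nat \<times> nat, 'o, 'm) cfun"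

definition nerve :: "('o, 'm) cat \<Rightarrow> ('o, 'm) nerve_simplex sset" where
  "nerve C =
    \<lparr>Smp = (\<lambda>n. {\<sigma>. cat_functor (ordinal_cat n) C \<sigma> \<and> restrict_fun (ordinal_cat n) \<sigma> = \<sigma>}),
     Act = (\<lambda>m n \<theta> \<sigma>. restrict_fun (ordinal_cat m) (\<sigma> \<cdot>\<^sub>F ordinal_functor \<theta>))\<rparr>"

definition nerve_map :: "('o, 'm, 'p, 'n) cfun \<Rightarrow> nat \<Rightarrow>
    ('o, 'm) nerve_simplex \<Rightarrow> ('p, 'n) nerve_simplex" where
  "nerve_map F n \<sigma> = restrict_fun (ordinal_cat n) (F \<cdot>\<^sub>F \<sigma>)"

lemma Hom_ordinal_cat: "f \<in> Hom (ordinal_cat n) i j \<longleftrightarrow> f = (i, j) \<and> i \<le> j \<and> j \<le> n"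
  by (cases f) (auto simp: ordinal_cat_def Hom_def)

lemma ordinal_cat_simps:
  "Ob (ordinal_cat n) = {..n}"
  "Ide (ordinal_cat n) i = (i, i)"
  "Comp (ordinal_cat n) (j, k) (i, j') = (i, k)"
  "(i, j) \<in> Ar (ordinal_cat n) \<longleftrightarrow> i \<le> j \<and> j \<le> n"
  by (simp_all add: ordinal_cat_def)

lemma category_ordinal_cat: "category (ordinal_cat n)"
  by unfold_locales (auto simp: ordinal_cat_def Hom_def)

lemma restrict_fun_idem: "restrict_fun C (restrict_fun C F) = restrict_fun C F"
  by (simp add: restrict_fun_def)

lemma cat_functor_restrict_fun:
  assumes "cat_functor C D F"
  shows "cat_functor C D (restrict_fun C F)"
proof -
  interpret cat_functor C D F by fact
  have ob: "FOb (restrict_fun C F) x = FOb F x" if "x \<in> Ob C" for x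
    using that by (simp add: restrict_fun_def)
  have ar: "FAr (restrict_fun C F) f = FAr F f" if "f \<in> Hom C x y" for f x y
    using that by (simp add: restrict_fun_def Hom_def)
  have xy: "x \<in> Ob C" "y \<in> Ob C" if "f \<in> Hom C x y" for f x y
    using that source.dom_in source.cod_in by (auto simp: Hom_def)
  show ?thesis
  proof
    show "FOb (restrict_fun C F) x \<in> Ob D" if "x \<in> Ob C" for x
      using ob_in that by (simp add: ob)
    show "FAr (restrict_fun C F) f \<in> Hom D (FOb (restrict_fun C F) x) (FOb (restrict_fun C F) y)"
      if "f \<in> Hom C x y" for f x y
      using ar_in[OF that] by (simp add: ob ar[OF that] xy[OF that])
    show "FAr (restrict_fun C F) (Ide C x) = Ide D (FOb (restrict_fun C F) x)" if "x \<in> Ob C" for x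
      using map_ide[OF that] by (simp add: ob[OF that] ar[OF source.ide_in[OF that]])
    show "FAr (restrict_fun C F) (Comp C g f) =
        Comp D (FAr (restrict_fun C F) g) (FAr (restrict_fun C F) f)"
      if "f \<in> Hom C x y" "g \<in> Hom C y z" for f g x y z
      using map_comp[OF that] by (simp add: ar[OF that(1)] ar[OF that(2)] ar[OF source.comp_in[OF that]])
  qed
qed

lemma cat_functor_comp_fun:
  assumes "cat_functor C D F" "cat_functor D E G"
  shows "cat_functor C E (G \<cdot>\<^sub>F F)"
proof -
  interpret F: cat_functor C D F by fact
  interpret G: cat_functor D E G by fact
  show ?thesis
  proof
    show "FAr (G \<cdot>\<^sub>F F) (Comp C g f) = Comp E (FAr (G \<cdot>\<^sub>F F) g) (FAr (G \<cdot>\<^sub>F F) f)"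
      if "f \<in> Hom C x y" "g \<in> Hom C y z" for f g x y z
      using G.map_comp[OF F.ar_in[OF that(1)] F.ar_in[OF that(2)]] F.map_comp[OF that]
      by (simp add: comp_fun_def)
  qed (auto simp: comp_fun_def F.ob_in G.ob_in F.map_ide G.map_ide intro: F.ar_in G.ar_in)
qed

lemma cat_functor_ordinal_functor:
  assumes "\<theta> \<in> mono_maps m n"
  shows "cat_functor (ordinal_cat m) (ordinal_cat n) (ordinal_functor \<theta>)"
proof -
  have le: "\<theta> i \<le> \<theta> j" if "i \<le> j" "j \<le> m" for i j
    using assms that by (simp add: mono_maps_def monotone_on_def)
  have bound: "\<theta> j \<le> n" if "j \<le> m" for j
    using assms that by (auto simp: mono_maps_def)
  show ?thesis
    using le bound
    by (intro cat_functor.intro cat_functor_axioms.intro category_ordinal_cat)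
      (auto simp: Hom_ordinal_cat ordinal_cat_simps ordinal_functor_def)
qed

lemma simplicial_set_nerve: "simplicial_set (nerve C)"
proof
  fix \<theta> m n \<sigma>
  assume "\<theta> \<in> mono_maps m n" "\<sigma> \<in> Smp (nerve C) n"
  then show "Act (nerve C) m n \<theta> \<sigma> \<in> Smp (nerve C) m"
    by (auto simp: nerve_def restrict_fun_idem
        intro: cat_functor_restrict_fun cat_functor_comp_fun cat_functor_ordinal_functor)
next
  fix n \<sigma> assume "\<sigma> \<in> Smp (nerve C) n"
  then have "restrict_fun (ordinal_cat n) \<sigma> = \<sigma>"
    by (simp add: nerve_def)
  moreover have "restrict_fun (ordinal_cat n) (\<sigma> \<cdot>\<^sub>F ordinal_functor (restrict id {..n})) =
      restrict_fun (ordinal_cat n) \<sigma>"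
    by (auto simp: restrict_fun_def comp_fun_def ordinal_functor_def ordinal_cat_def restrict_def fun_eq_iff)
  ultimately show "Act (nerve C) n n (restrict id {..n}) \<sigma> = \<sigma>"
    by (simp add: nerve_def)
next
  fix \<theta> \<phi> l m n \<sigma>
  assume \<theta>: "\<theta> \<in> mono_maps l m" and "\<phi> \<in> mono_maps m n" "\<sigma> \<in> Smp (nerve C) n"
  have le: "\<theta> i \<le> \<theta> j" if "i \<le> j" "j \<le> l" for i j
    using \<theta> that by (simp add: mono_maps_def monotone_on_def)
  have bound: "\<theta> j \<le> m" if "j \<le> l" for j
    using \<theta> that by (auto simp: mono_maps_def)
  have "FOb (Act (nerve C) l m \<theta> (Act (nerve C) m n \<phi> \<sigma>)) =
      FOb (Act (nerve C) l n (compose {..l} \<phi> \<theta>) \<sigma>)"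
    using bound
    by (auto simp: nerve_def restrict_fun_def comp_fun_def ordinal_functor_def ordinal_cat_simps
        compose_def fun_eq_iff restrict_def)
  moreover have "FAr (Act (nerve C) l m \<theta> (Act (nerve C) m n \<phi> \<sigma>)) p =
      FAr (Act (nerve C) l n (compose {..l} \<phi> \<theta>) \<sigma>) p" for p
    using le bound
    by (cases p) (simp add: nerve_def restrict_fun_def comp_fun_def ordinal_functor_def
        ordinal_cat_simps compose_def)
  ultimately show "Act (nerve C) l m \<theta> (Act (nerve C) m n \<phi> \<sigma>) =
      Act (nerve C) l n (compose {..l} \<phi> \<theta>) \<sigma>"
    by (intro cfun.equality) auto
qed


section \<open>Geometric realization\<close>

text \<open>
  The realization of \<open>X\<close> is the quotient of the disjoint union of the spaces \<open>X\<^sub>n \<times> \<Delta>\<^sup>n\<close>,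
  with \<open>X\<^sub>n\<close> discrete, by the equivalence relation generated by
  \<open>(\<theta>\<^sup>* x, t) \<sim> (x, \<theta>\<^sub>* t)\<close>, where \<open>\<theta> : [m] \<rightarrow> [n]\<close>, \<open>x \<in> X\<^sub>n\<close> and \<open>t \<in> \<Delta>\<^sup>m\<close>. Its points are the
  equivalence classes.
\<close>

type_synonym 'x prepoint = "nat \<times> 'x \<times> (nat \<Rightarrow> real)"

definition simplex_map :: "nat \<Rightarrow> (nat \<Rightarrow> nat) \<Rightarrow> (nat \<Rightarrow> real) \<Rightarrow> nat \<Rightarrow> real" where
  "simplex_map m \<theta> t = (\<lambda>i. \<Sum>j\<in>{j. j \<le> m \<and> \<theta> j = i}. t j)"

definition prerealization :: "'x sset \<Rightarrow> 'x prepoint topology" where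
  "prerealization X =
    sum_topology (\<lambda>n. prod_topology (discrete_topology (Smp X n))
                        (subtopology (powertop_real UNIV) (standard_simplex n))) UNIV"

definition glue :: "'x sset \<Rightarrow> 'x prepoint \<Rightarrow> 'x prepoint \<Rightarrow> bool" where
  "glue X p q \<longleftrightarrow> (\<exists>m n \<theta> x t. \<theta> \<in> mono_maps m n \<and> x \<in> Smp X n \<and> t \<in> standard_simplex m \<and>
     p = (m, Act X m n \<theta> x, t) \<and> q = (n, x, simplex_map m \<theta> t))"

definition glue_class :: "'x sset \<Rightarrow> 'x prepoint \<Rightarrow> 'x prepoint set" where
  "glue_class X p = Collect (equivclp (glue X) p)"

definition quotient_topology :: "'a topology \<Rightarrow> ('a \<Rightarrow> 'b) \<Rightarrow> 'b topology" where
  "quotient_topology X q =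
    topology (\<lambda>U. U \<subseteq> q ` topspace X \<and> openin X {x \<in> topspace X. q x \<in> U})"

definition realization :: "'x sset \<Rightarrow> 'x prepoint set topology" where
  "realization X = quotient_topology (prerealization X) (glue_class X)"

definition realization_map :: "'y sset \<Rightarrow> (nat \<Rightarrow> 'x \<Rightarrow> 'y) \<Rightarrow> 'x prepoint set \<Rightarrow> 'y prepoint set" where
  "realization_map Y f K = (\<Union>(n, x, t)\<in>K. glue_class Y (n, f n x, t))"

lemma istopology_quotient:
  "istopology (\<lambda>U. U \<subseteq> q ` topspace X \<and> openin X {x \<in> topspace X. q x \<in> U})"
proof -
  have int: "{x \<in> topspace X. q x \<in> S \<inter> T} =
        {x \<in> topspace X. q x \<in> S} \<inter> {x \<in> topspace X. q x \<in> T}" for S T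
    by auto
  have un: "{x \<in> topspace X. q x \<in> \<Union>\<U>} = (\<Union>U\<in>\<U>. {x \<in> topspace X. q x \<in> U})" for \<U>
    by auto
  show ?thesis
    unfolding istopology_def int un
    by (intro conjI allI impI) (auto intro!: openin_Int openin_Union)
qed

lemma openin_quotient_topology:
  "openin (quotient_topology X q) U \<longleftrightarrow>
     U \<subseteq> q ` topspace X \<and> openin X {x \<in> topspace X. q x \<in> U}"
  unfolding quotient_topology_def topology_inverse'[OF istopology_quotient] ..

lemma topspace_quotient_topology: "topspace (quotient_topology X q) = q ` topspace X"
proof
  show "topspace (quotient_topology X q) \<subseteq> q ` topspace X"
    using openin_quotient_topology[of X q "topspace (quotient_topology X q)"] by simp
  have "{x \<in> topspace X. q x \<in> q ` topspace X} = topspace X"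
    by auto
  then have "openin (quotient_topology X q) (q ` topspace X)"
    by (simp add: openin_quotient_topology)
  then show "q ` topspace X \<subseteq> topspace (quotient_topology X q)"
    by (rule openin_subset)
qed

lemma quotient_map_quotient_topology: "quotient_map X (quotient_topology X q) q"
  unfolding quotient_map_def topspace_quotient_topology openin_quotient_topology by blast


section \<open>Weak homotopy equivalences\<close>

definition cube :: "nat \<Rightarrow> (nat \<Rightarrow> real) topology" where
  "cube n = product_topology (\<lambda>_. top_of_set {0..1}) {..<n}"

definition cube_boundary :: "nat \<Rightarrow> (nat \<Rightarrow> real) set" where
  "cube_boundary n = {z \<in> topspace (cube n). \<exists>i<n. z i = 0 \<or> z i = 1}"

definition cube_maps :: "nat \<Rightarrow> 'a topology \<Rightarrow> 'a \<Rightarrow> ((nat \<Rightarrow> real) \<Rightarrow> 'a) set" where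
  "cube_maps n X x = {f. continuous_map (cube n) X f \<and> (\<forall>z\<in>cube_boundary n. f z = x)}"

definition cube_homotopic :: "nat \<Rightarrow> 'a topology \<Rightarrow> 'a \<Rightarrow>
    (((nat \<Rightarrow> real) \<Rightarrow> 'a) \<times> ((nat \<Rightarrow> real) \<Rightarrow> 'a)) set" where
  "cube_homotopic n X x =
    {(f, g). homotopic_with (\<lambda>h. \<forall>z\<in>cube_boundary n. h z = x) (cube n) X f g}"

text \<open>The underlying set of the \<open>n\<close>-th homotopy group, for \<open>n \<ge> 1\<close>.\<close>

definition homotopy_classes :: "nat \<Rightarrow> 'a topology \<Rightarrow> 'a \<Rightarrow> ((nat \<Rightarrow> real) \<Rightarrow> 'a) set set" where
  "homotopy_classes n X x = cube_maps n X x // cube_homotopic n X x"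

text \<open>
  The maps induced on homotopy groups are homomorphisms, so it suffices to require them to be
  bijective.
\<close>

definition weak_homotopy_equivalence :: "'a topology \<Rightarrow> 'b topology \<Rightarrow> ('a \<Rightarrow> 'b) \<Rightarrow> bool" where
  "weak_homotopy_equivalence X Y f \<longleftrightarrow>
     continuous_map X Y f \<and>
     bij_betw (\<lambda>K. \<Union>x\<in>K. path_component_of_set Y (f x)) (path_components_of X) (path_components_of Y) \<and>
     (\<forall>n\<ge>1. \<forall>x\<in>topspace X.
        bij_betw (\<lambda>K. cube_homotopic n Y (f x) `` ((\<circ>) f ` K))
          (homotopy_classes n X x) (homotopy_classes n Y (f x)))"

definition simplicial_weak_equivalence :: "'x sset \<Rightarrow> 'y sset \<Rightarrow> (nat \<Rightarrow> 'x \<Rightarrow> 'y) \<Rightarrow> bool" where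
  "simplicial_weak_equivalence X Y f \<longleftrightarrow>
     weak_homotopy_equivalence (realization X) (realization Y) (realization_map Y f)"


section \<open>The classes of functors \<open>\<W>\<^sub>\<infinity>\<close> and \<open>\<W>\<^sub>0\<close>, asphericity and exactness\<close>

definition W_infinity :: "('o, 'm) cat \<Rightarrow> ('p, 'n) cat \<Rightarrow> ('o, 'm, 'p, 'n) cfun \<Rightarrow> bool" where
  "W_infinity C D F \<longleftrightarrow> cat_functor C D F \<and>
     simplicial_weak_equivalence (nerve C) (nerve D) (nerve_map F)"

definition conn_rel :: "('o, 'm) cat \<Rightarrow> ('o \<times> 'o) set" where
  "conn_rel C = {(x, y). x \<in> Ob C \<and> y \<in> Ob C \<and> equivclp (\<lambda>x y. Hom C x y \<noteq> {}) x y}"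

definition connected_components :: "('o, 'm) cat \<Rightarrow> 'o set set" where
  "connected_components C = Ob C // conn_rel C"

definition W_zero :: "('o, 'm) cat \<Rightarrow> ('p, 'n) cat \<Rightarrow> ('o, 'm, 'p, 'n) cfun \<Rightarrow> bool" where
  "W_zero C D F \<longleftrightarrow> cat_functor C D F \<and>
     bij_betw (\<lambda>K. conn_rel D `` (FOb F ` K)) (connected_components C) (connected_components D)"

definition terminal_cat :: "(unit, unit) cat" where
  "terminal_cat = \<lparr>Ob = {()}, Ar = {()}, Dom = (\<lambda>_. ()), Cod = (\<lambda>_. ()),
     Ide = (\<lambda>_. ()), Comp = (\<lambda>_ _. ())\<rparr>"

definition to_terminal :: "('o, 'm, unit, unit) cfun" where
  "to_terminal = \<lparr>FOb = \<lambda>_. (), FAr = \<lambda>_. ()\<rparr>"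

lemma category_terminal_cat: "category terminal_cat"
  by unfold_locales (auto simp: terminal_cat_def Hom_def)

lemma cat_functor_to_terminal: "category C \<Longrightarrow> cat_functor C terminal_cat to_terminal"
  by (intro cat_functor.intro cat_functor_axioms.intro category_terminal_cat)
    (auto simp: terminal_cat_def to_terminal_def Hom_def)

text \<open>The parameter \<open>\<W>\<close> is to be instantiated with \<open>W_infinity\<close> or \<open>W_zero\<close>.\<close>

definition aspherical :: "(('o, 'm) cat \<Rightarrow> (unit, unit) cat \<Rightarrow> ('o, 'm, unit, unit) cfun \<Rightarrow> bool) \<Rightarrow>
    ('o, 'm) cat \<Rightarrow> bool" where
  "aspherical \<W> C \<longleftrightarrow> \<W> C terminal_cat to_terminal"

definition exact_square where
  "exact_square \<W> A B A' B' v w u' u \<alpha> \<longleftrightarrow>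
     (\<forall>a\<in>Ob A. \<forall>b'\<in>Ob B'. \<forall>g\<in>Hom B (FOb u a) (FOb w b').
        aspherical \<W> (fibre_cat A B A' B' v w u' u \<alpha> a b' g))"

end

(*
Let r and r' be the right adjoints of u and u'. By adjunction, an object of the category of triples
over (a, b', g) amounts to an object a' with f : a -> v(a') and h : a' -> r'(b'), so this category
splits as a disjoint union indexed by the k = v(h) f : a -> v r'(b') which the base change morphism
sends to the transpose of g, and each summand has a terminal object. Connectedness of all these
categories therefore says that every arrow to r w(b') factors uniquely through the base change
morphism, i.e. that it is an isomorphism; and then they have terminal objects. A category with
a terminal object has a contractible nerve, and a weak equivalence of nerves induces a bijection
on connected components. Finally, a terminal object of the category of triples is a universal
arrow from the functor between the categories under a and u(a).
*)

theory Submission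
  imports Defs "HOL-Analysis.Abstract_Topological_Spaces"
begin

section \<open>Adjunctions and universal arrows\<close>

text \<open>The implications run (a) => (e) => (b) => (c) => (a), with (d) <=> (e) proved
  separately. The striking step is (c) => (a): since every summand of a category of triples has a
  terminal object, the set of summands is its only homotopical content, so connectedness is as
  strong as asphericity. The inverse of the base change morphism then comes from a Yoneda argument,
  with two well-chosen arrows \<open>g\<close>. The topology meets two obstacles. A terminal object
  contracts the realization freely, whereas homotopy groups allow only homotopies fixed on the
  boundary of a cube, so the path traced by the base point has to be absorbed. And the contraction
  lives on a quotient space: it is written on the disjoint union of simplices and descends because
  the interval is locally compact. Weak equivalences only have to be recognized towards a point,
  which reduces all the required bijections to maps between singletons.\<close>

lemma (in category) Hom_ob: "f \<in> Hom C x y \<Longrightarrow> x \<in> Ob C \<and> y \<in> Ob C"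
  using dom_in cod_in by (auto simp: Hom_def)

text \<open>Pointwise inverses are automatically natural: insert \<open>\<tau> \<sigma> = 1\<close>
  on one side of the naturality square of \<tau> and cancel \<open>\<sigma> \<tau> = 1\<close> on
  the other. Invertibility can thus be checked one object at a time.\<close>

lemma nat_isoI:
  assumes "nat_trans C D F G \<tau>"
    and inv: "\<And>x. x \<in> Ob C \<Longrightarrow> \<exists>s\<in>Hom D (FOb G x) (FOb F x).
      Comp D s (\<tau> x) = Ide D (FOb F x) \<and> Comp D (\<tau> x) s = Ide D (FOb G x)"
  shows "nat_iso C D F G \<tau>"
proof -
  interpret nat_trans C D F G \<tau> by fact
  obtain \<sigma> where \<sigma>: "\<And>x. x \<in> Ob C \<Longrightarrow> \<sigma> x \<in> Hom D (FOb G x) (FOb F x)"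
    and \<sigma>\<tau>: "\<And>x. x \<in> Ob C \<Longrightarrow> Comp D (\<sigma> x) (\<tau> x) = Ide D (FOb F x)"
    and \<tau>\<sigma>: "\<And>x. x \<in> Ob C \<Longrightarrow> Comp D (\<tau> x) (\<sigma> x) = Ide D (FOb G x)"
    using inv by metis
  have "nat_trans C D G F \<sigma>"
  proof (intro nat_trans.intro nat_trans_axioms.intro \<sigma>)
    show "cat_functor C D F" "cat_functor C D G"
      by unfold_locales
    fix f x y assume f: "f \<in> Hom C x y"
    then have x: "x \<in> Ob C" and y: "y \<in> Ob C"
      using source.source.Hom_ob by auto
    note Ff = source.ar_in[OF f] and Gf = target.ar_in[OF f]
    note in\<sigma> = \<sigma>[OF x] \<sigma>[OF y] and in\<tau> = component_in[OF x] component_in[OF y]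
    have "Comp D (\<sigma> y) (FAr G f) = Comp D (\<sigma> y) (Comp D (FAr G f) (Comp D (\<tau> x) (\<sigma> x)))"
      using source.target.comp_ide_right[OF Gf] \<tau>\<sigma>[OF x] by simp
    also have "\<dots> = Comp D (\<sigma> y) (Comp D (Comp D (\<tau> y) (FAr F f)) (\<sigma> x))"
      using source.target.comp_assoc[OF in\<sigma>(1) in\<tau>(1) Gf] naturality[OF f] by simp
    also have "\<dots> = Comp D (Comp D (\<sigma> y) (\<tau> y)) (Comp D (FAr F f) (\<sigma> x))"
      using source.target.comp_assoc[OF in\<sigma>(1) Ff in\<tau>(2)]
        source.target.comp_assoc[OF source.target.comp_in[OF in\<sigma>(1) Ff] in\<tau>(2) in\<sigma>(2)] by simp
    also have "\<dots> = Comp D (FAr F f) (\<sigma> x)"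
      using source.target.comp_ide_left[OF source.target.comp_in[OF in\<sigma>(1) Ff]] \<sigma>\<tau>[OF y] by simp
    finally show "Comp D (\<sigma> y) (FAr G f) = Comp D (FAr F f) (\<sigma> x)" .
  qed
  then show ?thesis
    using assms(1) \<sigma>\<tau> \<tau>\<sigma> by (auto simp: nat_iso_def vcomp_def id_nat_def)
qed

locale adjoint_pair =
  fixes C :: "('o, 'm) cat" and D :: "('p, 'n) cat" and F G \<eta> \<epsilon>
  assumes adjunction: "adjunction C D F G \<eta> \<epsilon>"
begin

sublocale left: cat_functor C D F
  using adjunction by (simp add: adjunction_def)

sublocale right: cat_functor D C G
  using adjunction by (simp add: adjunction_def)

sublocale unit: nat_trans C C id_fun "G \<cdot>\<^sub>F F" \<eta>
  using adjunction by (simp add: adjunction_def)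

sublocale counit: nat_trans D D "F \<cdot>\<^sub>F G" id_fun \<epsilon>
  using adjunction by (simp add: adjunction_def)

lemma unit_in: "x \<in> Ob C \<Longrightarrow> \<eta> x \<in> Hom C x (FOb G (FOb F x))"
  using unit.component_in by (simp add: comp_fun_def id_fun_def)

lemma counit_in: "y \<in> Ob D \<Longrightarrow> \<epsilon> y \<in> Hom D (FOb F (FOb G y)) y"
  using counit.component_in by (simp add: comp_fun_def id_fun_def)

lemma unit_nat: "f \<in> Hom C x y \<Longrightarrow> Comp C (FAr G (FAr F f)) (\<eta> x) = Comp C (\<eta> y) f"
  using unit.naturality by (simp add: comp_fun_def id_fun_def)

lemma counit_nat: "f \<in> Hom D x y \<Longrightarrow> Comp D (\<epsilon> y) (FAr F (FAr G f)) = Comp D f (\<epsilon> x)"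
  using counit.naturality by (simp add: comp_fun_def id_fun_def)

lemma triangle_left: "x \<in> Ob C \<Longrightarrow> Comp D (\<epsilon> (FOb F x)) (FAr F (\<eta> x)) = Ide D (FOb F x)"
  using adjunction by (simp add: adjunction_def vcomp_def whisker_l_def whisker_r_def id_nat_def)

lemma triangle_right: "y \<in> Ob D \<Longrightarrow> Comp C (FAr G (\<epsilon> y)) (\<eta> (FOb G y)) = Ide C (FOb G y)"
  using adjunction by (simp add: adjunction_def vcomp_def whisker_l_def whisker_r_def id_nat_def)

lemma transpose_in:
  assumes "x \<in> Ob C" "g \<in> Hom D (FOb F x) y"
  shows "Comp C (FAr G g) (\<eta> x) \<in> Hom C x (FOb G y)"
  using left.source.comp_in[OF unit_in right.ar_in] assms by blast

lemma counit_transpose: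
  assumes x: "x \<in> Ob C" and g: "g \<in> Hom D (FOb F x) y"
  shows "Comp D (\<epsilon> y) (FAr F (Comp C (FAr G g) (\<eta> x))) = g"
proof -
  have y: "y \<in> Ob D"
    using left.target.Hom_ob[OF g] ..
  have "Comp D (\<epsilon> y) (FAr F (Comp C (FAr G g) (\<eta> x))) =
      Comp D (Comp D (\<epsilon> y) (FAr F (FAr G g))) (FAr F (\<eta> x))"
    using left.target.comp_assoc[OF left.ar_in[OF unit_in[OF x]] left.ar_in[OF right.ar_in[OF g]] counit_in[OF y]]
      left.map_comp[OF unit_in[OF x] right.ar_in[OF g]] by simp
  also have "\<dots> = Comp D g (Comp D (\<epsilon> (FOb F x)) (FAr F (\<eta> x)))"
    using left.target.comp_assoc[OF left.ar_in[OF unit_in[OF x]] counit_in[OF left.ob_in[OF x]] g]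
      counit_nat[OF g] by simp
  also have "\<dots> = g"
    using triangle_left[OF x] left.target.comp_ide_right[OF g] by simp
  finally show ?thesis .
qed

text \<open>Naturality of the unit and the second triangle identity. Together with
  \<open>counit_transpose\<close> this is the bijection of hom-sets, so that arrows into
  \<open>G y\<close> may be compared after applying \<open>F\<close> and composing with
  \<open>\<epsilon> y\<close>.\<close>

lemma transpose_unique:
  assumes y: "y \<in> Ob D" and k: "k \<in> Hom C x (FOb G y)" and g: "Comp D (\<epsilon> y) (FAr F k) = g"
  shows "k = Comp C (FAr G g) (\<eta> x)"
proof -
  have x: "x \<in> Ob C"
    using left.source.Hom_ob[OF k] ..
  note GFk = right.ar_in[OF left.ar_in[OF k]] and Ge = right.ar_in[OF counit_in[OF y]]
  have "Comp C (FAr G g) (\<eta> x) = Comp C (Comp C (FAr G (\<epsilon> y)) (FAr G (FAr F k))) (\<eta> x)"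
    using right.map_comp[OF left.ar_in[OF k] counit_in[OF y]] g by simp
  also have "\<dots> = Comp C (FAr G (\<epsilon> y)) (Comp C (\<eta> (FOb G y)) k)"
    using left.source.comp_assoc[OF unit_in[OF x] GFk Ge] unit_nat[OF k] by simp
  also have "\<dots> = k"
    using left.source.comp_assoc[OF k unit_in[OF right.ob_in[OF y]] Ge] triangle_right[OF y]
      left.source.comp_ide_left[OF k] by simp
  finally show ?thesis by simp
qed

end

text \<open>In other words, \<open>(x, e)\<close> is a terminal object of the comma category of
  \<open>F\<close> over \<open>y\<close>. In this form right adjoints can be found object by object,
  without any functoriality.\<close>

definition universal_arrow :: "('o, 'm) cat \<Rightarrow> ('p, 'n) cat \<Rightarrow> ('o, 'm, 'p, 'n) cfun \<Rightarrow> 'p \<Rightarrow> 'o \<Rightarrow> 'n \<Rightarrow> bool"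
  where "universal_arrow C D F y x e \<longleftrightarrow> x \<in> Ob C \<and> e \<in> Hom D (FOb F x) y \<and>
    (\<forall>z\<in>Ob C. \<forall>g\<in>Hom D (FOb F z) y. \<exists>!h. h \<in> Hom C z x \<and> Comp D e (FAr F h) = g)"

lemma (in adjoint_pair) universal_arrow_counit:
  assumes y: "y \<in> Ob D"
  shows "universal_arrow C D F y (FOb G y) (\<epsilon> y)"
  unfolding universal_arrow_def
  using right.ob_in[OF y] counit_in[OF y] transpose_in counit_transpose transpose_unique[OF y]
  by (intro conjI ballI ex1I[of _ "Comp C (FAr G _) (\<eta> _)"]) auto

text \<open>Only the objects \<open>R y\<close> and the arrows \<open>\<epsilon> y\<close> are
  chosen; the right adjoint on arrows and the unit are forced as factorizations. Identities between
  arrows into \<open>R y\<close> are proved by comparing both sides after \<open>F\<close> and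
  \<open>\<epsilon> y\<close>, which is \<open>\<epsilon>_inj\<close>.\<close>

lemma (in cat_functor) has_right_adjointI:
  assumes "\<And>y. y \<in> Ob D \<Longrightarrow> \<exists>x e. universal_arrow C D F y x e"
  shows "has_right_adjoint C D F"
proof -
  obtain R \<epsilon> where R\<epsilon>: "\<And>y. y \<in> Ob D \<Longrightarrow> universal_arrow C D F y (R y) (\<epsilon> y)"
    using assms by metis
  have R: "\<And>y. y \<in> Ob D \<Longrightarrow> R y \<in> Ob C" and \<epsilon>: "\<And>y. y \<in> Ob D \<Longrightarrow> \<epsilon> y \<in> Hom D (FOb F (R y)) y"
    using R\<epsilon> by (auto simp: universal_arrow_def)
  define \<phi> where "\<phi> z y g = (THE h. h \<in> Hom C z (R y) \<and> Comp D (\<epsilon> y) (FAr F h) = g)" for z y g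
  have ex1: "\<exists>!h. h \<in> Hom C z (R y) \<and> Comp D (\<epsilon> y) (FAr F h) = g"
    if "z \<in> Ob C" "g \<in> Hom D (FOb F z) y" for z y g
    using R\<epsilon>[of y] that target.Hom_ob[OF that(2)] by (auto simp: universal_arrow_def)
  have \<phi>_in: "\<phi> z y g \<in> Hom C z (R y)" and \<epsilon>_\<phi>: "Comp D (\<epsilon> y) (FAr F (\<phi> z y g)) = g"
    if "z \<in> Ob C" "g \<in> Hom D (FOb F z) y" for z y g
    using theI'[OF ex1[OF that]] by (auto simp: \<phi>_def)
  have \<epsilon>_inj: "h = h'"
    if "y \<in> Ob D" "h \<in> Hom C z (R y)" "h' \<in> Hom C z (R y)"
      "Comp D (\<epsilon> y) (FAr F h) = Comp D (\<epsilon> y) (FAr F h')" for z y h h'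
    using ex1[of z "Comp D (\<epsilon> y) (FAr F h)" y] that source.Hom_ob[OF that(2)]
      target.comp_in[OF ar_in[OF that(2)] \<epsilon>[OF that(1)]] by auto
  \<comment> \<open>With these two definitions, naturality of \<epsilon> and the first triangle
    identity hold by construction.\<close>
  define G where "G = \<lparr>FOb = R, FAr = (\<lambda>f. \<phi> (R (Dom D f)) (Cod D f) (Comp D f (\<epsilon> (Dom D f))))\<rparr>"
  define \<eta> where "\<eta> x = \<phi> x (FOb F x) (Ide D (FOb F x))" for x
  have GOb [simp]: "FOb G y = R y" for y
    by (simp add: G_def)
  have f\<epsilon>: "Comp D f (\<epsilon> x) \<in> Hom D (FOb F (R x)) y" if "f \<in> Hom D x y" for f x y
    using that target.Hom_ob[OF that] target.comp_in[OF \<epsilon>] by blast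
  have G_in: "FAr G f \<in> Hom C (R x) (R y)"
    and \<epsilon>_G: "Comp D (\<epsilon> y) (FAr F (FAr G f)) = Comp D f (\<epsilon> x)" if f: "f \<in> Hom D x y" for f x y
    using \<phi>_in[OF R f\<epsilon>[OF f]] \<epsilon>_\<phi>[OF R f\<epsilon>[OF f]] f target.Hom_ob[OF f]
    by (simp_all add: G_def Hom_def)
  have G: "cat_functor D C G"
  proof (intro cat_functor.intro cat_functor_axioms.intro)
    show "category D" "category C"
      by unfold_locales
    fix x assume x: "x \<in> Ob D"
    show "FAr G (Ide D x) = Ide C (FOb G x)"
      using \<epsilon>_inj[OF x G_in[OF target.ide_in[OF x]] source.ide_in[OF R[OF x]]] \<epsilon>_G[OF target.ide_in[OF x]]
        target.comp_ide_left[OF \<epsilon>[OF x]] target.comp_ide_right[OF \<epsilon>[OF x]] map_ide[OF R[OF x]] by simp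
  next
    fix f g x y z assume f: "f \<in> Hom D x y" and g: "g \<in> Hom D y z"
    have ob: "x \<in> Ob D" "y \<in> Ob D" "z \<in> Ob D"
      using target.Hom_ob[OF f] target.Hom_ob[OF g] by auto
    note gf = target.comp_in[OF f g]
    have "Comp D (\<epsilon> z) (FAr F (Comp C (FAr G g) (FAr G f))) =
        Comp D (Comp D (\<epsilon> z) (FAr F (FAr G g))) (FAr F (FAr G f))"
      using map_comp[OF G_in[OF f] G_in[OF g]]
        target.comp_assoc[OF ar_in[OF G_in[OF f]] ar_in[OF G_in[OF g]] \<epsilon>[OF ob(3)]] by simp
    also have "\<dots> = Comp D g (Comp D (\<epsilon> y) (FAr F (FAr G f)))"
      using \<epsilon>_G[OF g] target.comp_assoc[OF ar_in[OF G_in[OF f]] \<epsilon>[OF ob(2)] g] by simp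
    also have "\<dots> = Comp D (\<epsilon> z) (FAr F (FAr G (Comp D g f)))"
      using \<epsilon>_G[OF f] \<epsilon>_G[OF gf] target.comp_assoc[OF \<epsilon>[OF ob(1)] f g] by simp
    finally show "FAr G (Comp D g f) = Comp C (FAr G g) (FAr G f)"
      using \<epsilon>_inj[OF ob(3) G_in[OF gf] source.comp_in[OF G_in[OF f] G_in[OF g]]] by simp
  qed (use R G_in in auto)
  have \<eta>_in: "\<eta> x \<in> Hom C x (R (FOb F x))"
    and \<epsilon>_\<eta>: "Comp D (\<epsilon> (FOb F x)) (FAr F (\<eta> x)) = Ide D (FOb F x)" if "x \<in> Ob C" for x
    using \<phi>_in[OF that target.ide_in[OF ob_in[OF that]]] \<epsilon>_\<phi>[OF that target.ide_in[OF ob_in[OF that]]]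
    by (simp_all add: \<eta>_def)
  \<comment> \<open>So \<open>G g\<close> after \<eta> is the factorization of \<open>g\<close>. The
    cases \<open>g = F f\<close> and \<open>g = \<epsilon> y\<close> yield naturality of the unit
    and the second triangle identity.\<close>
  have G\<phi>: "Comp D (\<epsilon> y) (FAr F (Comp C (FAr G g) (\<eta> x))) = g"
    if x: "x \<in> Ob C" and g: "g \<in> Hom D (FOb F x) y" for x y g
  proof -
    have y: "y \<in> Ob D"
      using target.Hom_ob[OF g] ..
    have "Comp D (\<epsilon> y) (FAr F (Comp C (FAr G g) (\<eta> x))) =
        Comp D (Comp D (\<epsilon> y) (FAr F (FAr G g))) (FAr F (\<eta> x))"
      using map_comp[OF \<eta>_in[OF x] G_in[OF g]]
        target.comp_assoc[OF ar_in[OF \<eta>_in[OF x]] ar_in[OF G_in[OF g]] \<epsilon>[OF y]] by simp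
    also have "\<dots> = g"
      using \<epsilon>_G[OF g] target.comp_assoc[OF ar_in[OF \<eta>_in[OF x]] \<epsilon>[OF ob_in[OF x]] g] \<epsilon>_\<eta>[OF x]
        target.comp_ide_right[OF g] by simp
    finally show ?thesis .
  qed
  have "nat_trans C C id_fun (G \<cdot>\<^sub>F F) \<eta>"
  proof (intro nat_trans.intro nat_trans_axioms.intro)
    show "cat_functor C C id_fun"
      by unfold_locales (auto simp: id_fun_def)
    show "cat_functor C C (G \<cdot>\<^sub>F F)"
      using cat_functor_comp_fun[OF cat_functor_axioms G] .
    fix f x y assume f: "f \<in> Hom C x y"
    then have ob: "x \<in> Ob C" "y \<in> Ob C"
      using source.Hom_ob by auto
    have "Comp D (\<epsilon> (FOb F y)) (FAr F (Comp C (\<eta> y) f)) = FAr F f"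
      using map_comp[OF f \<eta>_in[OF ob(2)]]
        target.comp_assoc[OF ar_in[OF f] ar_in[OF \<eta>_in[OF ob(2)]] \<epsilon>[OF ob_in[OF ob(2)]]]
        \<epsilon>_\<eta>[OF ob(2)] target.comp_ide_left[OF ar_in[OF f]] by simp
    then show "Comp C (\<eta> y) (FAr id_fun f) = Comp C (FAr (G \<cdot>\<^sub>F F) f) (\<eta> x)"
      using \<epsilon>_inj[OF ob_in[OF ob(2)] source.comp_in[OF f \<eta>_in[OF ob(2)]]
          source.comp_in[OF \<eta>_in[OF ob(1)] G_in[OF ar_in[OF f]]]] G\<phi>[OF ob(1) ar_in[OF f]]
      by (simp add: id_fun_def comp_fun_def)
  qed (use \<eta>_in in \<open>auto simp: id_fun_def comp_fun_def\<close>)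
  moreover have "nat_trans D D (F \<cdot>\<^sub>F G) id_fun \<epsilon>"
  proof (intro nat_trans.intro nat_trans_axioms.intro)
    show "cat_functor D D id_fun"
      by unfold_locales (auto simp: id_fun_def)
    show "cat_functor D D (F \<cdot>\<^sub>F G)"
      using cat_functor_comp_fun[OF G cat_functor_axioms] .
  qed (use \<epsilon> \<epsilon>_G in \<open>auto simp: id_fun_def comp_fun_def\<close>)
  moreover have "Comp C (FAr G (\<epsilon> y)) (\<eta> (R y)) = Ide C (R y)" if y: "y \<in> Ob D" for y
    using \<epsilon>_inj[OF y source.comp_in[OF \<eta>_in[OF R[OF y]] G_in[OF \<epsilon>[OF y]]] source.ide_in[OF R[OF y]]]
      G\<phi>[OF R[OF y] \<epsilon>[OF y]] map_ide[OF R[OF y]] target.comp_ide_right[OF \<epsilon>[OF y]] by simp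
  ultimately have "adjunction C D F G \<eta> \<epsilon>"
    using cat_functor_axioms G \<epsilon>_\<eta>
    by (simp add: adjunction_def vcomp_def whisker_l_def whisker_r_def id_nat_def)
  then show ?thesis
    by (auto simp: has_right_adjoint_def)
qed

lemma (in cat_functor) has_right_adjoint_iff:
  "has_right_adjoint C D F \<longleftrightarrow> (\<forall>y\<in>Ob D. \<exists>x e. universal_arrow C D F y x e)"
  using has_right_adjointI adjoint_pair.universal_arrow_counit[OF adjoint_pair.intro]
  unfolding has_right_adjoint_def by metis

section \<open>Connected components\<close>

text \<open>Equality of values is an equivalence, so generators suffice. A Boolean-valued
  \<open>f\<close> gives saturation of a set under the generated equivalence.\<close>

lemma equivclp_invariant:
  assumes "equivclp R x y" "\<And>x y. R x y \<Longrightarrow> f x = f y"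
  shows "f x = f y"
  using assms(1) by (induction rule: equivclp_induct) (metis assms(2))+

lemma equivclp_cong_right: "equivclp R y z \<Longrightarrow> equivclp R x y \<longleftrightarrow> equivclp R x z"
  by (blast intro: equivclp_trans equivclp_sym)

lemma conn_rel_terminal_cat: "conn_rel terminal_cat = {((), ())}"
  by (auto simp: conn_rel_def terminal_cat_def)

text \<open>The bijection asks for exactly one component. The existential over \<open>x\<close>
  excludes the empty category, which has none.\<close>

lemma W_zero_terminal_iff:
  assumes "category C"
  shows "W_zero C terminal_cat to_terminal \<longleftrightarrow> (\<exists>x\<in>Ob C. \<forall>y\<in>Ob C. (x, y) \<in> conn_rel C)"
proof -
  interpret category C by fact
  let ?f = "\<lambda>K. conn_rel terminal_cat `` (FOb (to_terminal :: ('a, 'b, unit, unit) cfun) ` K)"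
  have equiv: "equiv (Ob C) (conn_rel C)"
    by (auto simp: equiv_def refl_on_def sym_def trans_def conn_rel_def
        intro: equivclp_refl equivclp_sym equivclp_trans)
  have unit: "connected_components terminal_cat = {{()}}"
    unfolding connected_components_def conn_rel_terminal_cat quotient_def by (auto simp: terminal_cat_def)
  have f: "?f K = {()}" if "K \<in> Ob C // conn_rel C" for K
    using in_quotient_imp_non_empty[OF equiv that]
    by (auto simp: conn_rel_terminal_cat to_terminal_def)
  have "bij_betw ?f (Ob C // conn_rel C) {{()}} \<longleftrightarrow> (\<exists>K. Ob C // conn_rel C = {K})"
  proof
    assume "bij_betw ?f (Ob C // conn_rel C) {{()}}"
    then have inj: "inj_on ?f (Ob C // conn_rel C)" and "?f ` (Ob C // conn_rel C) = {{()}}"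
      unfolding bij_betw_def by blast+
    then obtain K where K: "K \<in> Ob C // conn_rel C"
      by (metis ex_in_conv image_empty insert_not_empty)
    have "L = K" if L: "L \<in> Ob C // conn_rel C" for L
      by (rule inj_onD[OF inj _ L K]) (simp only: f[OF K] f[OF L])
    then show "\<exists>K. Ob C // conn_rel C = {K}"
      using K by blast
  next
    assume "\<exists>K. Ob C // conn_rel C = {K}"
    then obtain K where K: "Ob C // conn_rel C = {K}" ..
    then have "?f K = {()}"
      by (intro f) simp
    then show "bij_betw ?f (Ob C // conn_rel C) {{()}}"
      unfolding K by (simp only: bij_betw_def inj_on_def) auto
  qed
  then have "W_zero C terminal_cat to_terminal \<longleftrightarrow> (\<exists>K. Ob C // conn_rel C = {K})"
    using unit unfolding W_zero_def connected_components_def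
    by (simp only: cat_functor_to_terminal[OF assms] simp_thms)
  also have "\<dots> \<longleftrightarrow> (\<exists>x\<in>Ob C. \<forall>y\<in>Ob C. (x, y) \<in> conn_rel C)"
  proof
    assume "\<exists>K. Ob C // conn_rel C = {K}"
    then obtain K where K: "Ob C // conn_rel C = {K}" ..
    then have "Ob C \<noteq> {}"
      by auto
    then obtain x where x: "x \<in> Ob C"
      by auto
    have "(x, y) \<in> conn_rel C" if y: "y \<in> Ob C" for y
    proof -
      have "conn_rel C `` {x} = conn_rel C `` {y}"
        using quotientI[OF x, of "conn_rel C"] quotientI[OF y, of "conn_rel C"] unfolding K by blast
      then show ?thesis
        using eq_equiv_class_iff[OF equiv x y] by blast
    qed
    with x show "\<exists>x\<in>Ob C. \<forall>y\<in>Ob C. (x, y) \<in> conn_rel C"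
      by blast
  next
    assume "\<exists>x\<in>Ob C. \<forall>y\<in>Ob C. (x, y) \<in> conn_rel C"
    then obtain x where x: "x \<in> Ob C" and xy: "\<And>y. y \<in> Ob C \<Longrightarrow> (x, y) \<in> conn_rel C"
      by blast
    have "Ob C // conn_rel C = {conn_rel C `` {x}}"
    proof (rule subset_antisym; rule subsetI)
      fix K assume "K \<in> Ob C // conn_rel C"
      then obtain y where "y \<in> Ob C" "K = conn_rel C `` {y}"
        by (rule quotientE)
      then show "K \<in> {conn_rel C `` {x}}"
        using equiv_class_eq[OF equiv xy] by blast
    next
      fix K assume "K \<in> {conn_rel C `` {x}}"
      then show "K \<in> Ob C // conn_rel C"
        using quotientI[OF x] by blast
    qed
    then show "\<exists>K. Ob C // conn_rel C = {K}" ..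
  qed
  finally show ?thesis .
qed

lemma conn_rel_invariant:
  assumes "(x, y) \<in> conn_rel C" and "\<And>x y h. h \<in> Hom C x y \<Longrightarrow> p x = p y"
  shows "p x = p y"
proof -
  have "equivclp (\<lambda>x y. Hom C x y \<noteq> {}) x y"
    using assms(1) by (simp add: conn_rel_def)
  then show ?thesis
    by (rule equivclp_invariant) (use assms(2) in blast)
qed

section \<open>The categories of triples\<close>

context cat_square
begin

abbreviation fibre where
  "fibre \<equiv> fibre_cat A B A' B' v w u' u \<alpha>"

text \<open>The underlying arrow of \<open>A'\<close> alone: once both ends are fixed it determines
  the recorded triple, so uniqueness can be discussed without carrying the ends along.\<close>

definition fibre_arrow where
  "fibre_arrow s t h \<longleftrightarrow> h \<in> Hom A' (fst s) (fst t) \<and> Comp A (FAr v h) (fst (snd s)) = fst (snd t) \<and>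
     Comp B' (snd (snd t)) (FAr u' h) = snd (snd s)"

lemma Hom_fibre:
  "Hom (fibre a b' g) s t =
    {(s, h, t) | h. s \<in> Ob (fibre a b' g) \<and> t \<in> Ob (fibre a b' g) \<and> fibre_arrow s t h}"
  by (auto simp: Hom_fibre_cat fibre_arrow_def)

lemma has_terminal_object_fibre_iff:
  "has_terminal_object (fibre a b' g) \<longleftrightarrow>
    (\<exists>t\<in>Ob (fibre a b' g). \<forall>s\<in>Ob (fibre a b' g). \<exists>!h. fibre_arrow s t h)"
  unfolding has_terminal_object_def Hom_fibre by (intro bex_cong ball_cong refl) auto

text \<open>The comma category of the induced functor over \<open>(b', g)\<close> is isomorphic to
  the category of triples: an arrow from the image of \<open>(x, k)\<close> to
  \<open>(b', g)\<close> amounts to the missing third component. Universal arrows therefore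
  correspond to terminal objects.\<close>

lemma universal_arrow_under_functor_iff:
  assumes "b' \<in> Ob B'" "g \<in> Hom B (FOb u a) (FOb w b')"
  shows "universal_arrow (under_cat A' A v a) (under_cat B' B w (FOb u a)) (under_functor B u' u \<alpha>)
      (b', g) (a', f) e \<longleftrightarrow>
    (\<exists>g'. e = ((FOb u' a', Comp B (\<alpha> a') (FAr u f)), g', (b', g)) \<and>
      (a', f, g') \<in> Ob (fibre a b' g) \<and> (\<forall>s\<in>Ob (fibre a b' g). \<exists>!h. fibre_arrow s (a', f, g') h))"
    (is "universal_arrow ?U ?V ?F _ _ _ \<longleftrightarrow> _")
proof -
  \<comment> \<open>The bijection on objects; \<open>arrow\<close> below is the one on arrows, and
    \<open>ex1\<close> strips the fixed ends.\<close>
  have hom: "e \<in> Hom ?V (FOb ?F (x, k)) (b', g) \<longleftrightarrow>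
      (\<exists>g'. e = ((FOb u' x, Comp B (\<alpha> x) (FAr u k)), g', (b', g)) \<and> (x, k, g') \<in> Ob (fibre a b' g))"
    if "(x, k) \<in> Ob ?U" for x k e
    using that assms u'.ob_in component_under[of x k a]
    by (auto simp: Hom_under_cat Ob_under_cat Ob_fibre_cat under_functor_def Let_def)
  have U: "(x, k) \<in> Ob ?U" if "(x, k, g') \<in> Ob (fibre a b' g)" for x k g'
    using that by (auto simp: Ob_fibre_cat Ob_under_cat)
  have arrow: "(h \<in> Hom ?U (x, k) (a', f) \<and>
      Comp ?V ((FOb u' a', Comp B (\<alpha> a') (FAr u f)), g', (b', g)) (FAr ?F h) =
        ((FOb u' x, Comp B (\<alpha> x) (FAr u k)), k', (b', g))) \<longleftrightarrow>
      (\<exists>h'. h = ((x, k), h', (a', f)) \<and> fibre_arrow (x, k, k') (a', f, g') h')"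
    if "(a', f) \<in> Ob ?U" "(x, k) \<in> Ob ?U" for x k k' g' h
    using that
    by (auto simp: Hom_under_cat under_functor_def Let_def under_cat_simps fibre_arrow_def)
  have ex1: "(\<exists>!h. \<exists>h'. h = ((x, k), h', (a', f)) \<and> P h') \<longleftrightarrow> (\<exists>!h'. P h')" for x k P
    by auto
  show ?thesis (is "?L \<longleftrightarrow> ?R")
  proof
    assume L: ?L
    then have af: "(a', f) \<in> Ob ?U"
      by (simp add: universal_arrow_def)
    then obtain g' where e: "e = ((FOb u' a', Comp B (\<alpha> a') (FAr u f)), g', (b', g))"
      and g': "(a', f, g') \<in> Ob (fibre a b' g)"
      using L hom by (auto simp: universal_arrow_def)
    have "\<exists>!h. fibre_arrow s (a', f, g') h" if s: "s \<in> Ob (fibre a b' g)" for s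
    proof -
      obtain x k k' where s_eq: "s = (x, k, k')"
        by (rule prod_cases3)
      note s = s[unfolded s_eq]
      have "\<exists>!h. h \<in> Hom ?U (x, k) (a', f) \<and> Comp ?V e (FAr ?F h) =
          ((FOb u' x, Comp B (\<alpha> x) (FAr u k)), k', (b', g))"
        using L U[OF s] hom[OF U[OF s]] s unfolding universal_arrow_def by blast
      then show ?thesis
        unfolding s_eq e arrow[OF af U[OF s]] ex1 .
    qed
    then show ?R
      using e g' by blast
  next
    assume ?R
    then obtain g' where e: "e = ((FOb u' a', Comp B (\<alpha> a') (FAr u f)), g', (b', g))"
      and g': "(a', f, g') \<in> Ob (fibre a b' g)"
      and ex: "\<And>s. s \<in> Ob (fibre a b' g) \<Longrightarrow> \<exists>!h. fibre_arrow s (a', f, g') h"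
      by auto
    note af = U[OF g']
    have "\<exists>!h. h \<in> Hom ?U z (a', f) \<and> Comp ?V e (FAr ?F h) = d"
      if z: "z \<in> Ob ?U" and d: "d \<in> Hom ?V (FOb ?F z) (b', g)" for z d
    proof -
      obtain x k where z_eq: "z = (x, k)"
        by (rule prod.exhaust)
      note xk = z[unfolded z_eq] and d = d[unfolded z_eq]
      obtain k' where d: "d = ((FOb u' x, Comp B (\<alpha> x) (FAr u k)), k', (b', g))"
        and k': "(x, k, k') \<in> Ob (fibre a b' g)"
        using d hom[OF xk] by auto
      show ?thesis
        unfolding z_eq e d arrow[OF af xk] ex1 using ex[OF k'] .
    qed
    then show ?L
      using af hom[OF af] e g' unfolding universal_arrow_def by blast
  qed
qed

lemma has_right_adjoint_under_functor_iff:
  assumes a: "a \<in> Ob A"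
  shows "has_right_adjoint (under_cat A' A v a) (under_cat B' B w (FOb u a)) (under_functor B u' u \<alpha>) \<longleftrightarrow>
    (\<forall>b'\<in>Ob B'. \<forall>g\<in>Hom B (FOb u a) (FOb w b'). has_terminal_object (fibre a b' g))"
proof -
  interpret F: cat_functor "under_cat A' A v a" "under_cat B' B w (FOb u a)" "under_functor B u' u \<alpha>"
    by (rule cat_functor_under_functor)
  have "(\<exists>x e. universal_arrow (under_cat A' A v a) (under_cat B' B w (FOb u a)) (under_functor B u' u \<alpha>)
      (b', g) x e) \<longleftrightarrow> has_terminal_object (fibre a b' g)"
    if "b' \<in> Ob B'" "g \<in> Hom B (FOb u a) (FOb w b')" for b' g
    unfolding has_terminal_object_fibre_iff split_paired_Ex
      universal_arrow_under_functor_iff[OF that] by (auto simp: Bex_def)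
  then show ?thesis
    unfolding F.has_right_adjoint_iff Ob_under_cat by auto
qed

end

section \<open>The base change morphism and the lifts of an arrow\<close>

locale adjoint_square =
  cat_square A B A' B' v w u' u \<alpha> +
  adj: adjoint_pair A B u r \<eta> \<epsilon> + adj': adjoint_pair A' B' u' r' \<eta>' \<epsilon>'
  for A :: "('a, 'am) cat" and B :: "('b, 'bm) cat"
    and A' :: "('c, 'cm) cat" and B' :: "('d, 'dm) cat"
    and v w u' u \<alpha> r \<eta> \<epsilon> r' \<eta>' \<epsilon>'
begin

abbreviation c where
  "c \<equiv> base_change A v w \<alpha> r r' \<eta> \<epsilon>'"

text \<open>The 2-cell from \<open>u v r'\<close> to \<open>w\<close> obtained by pasting the square
  with the counit \<epsilon>'. The base change morphism is its transpose under the adjunction of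
  \<open>u\<close> and \<open>r\<close>.\<close>

definition mate where
  "mate b' = Comp B (FAr w (\<epsilon>' b')) (\<alpha> (FOb r' b'))"

lemma \<alpha>_in: "x \<in> Ob A' \<Longrightarrow> \<alpha> x \<in> Hom B (FOb u (FOb v x)) (FOb w (FOb u' x))"
  using \<alpha>.component_in by (simp add: comp_fun_def)

lemma mate_in: "b' \<in> Ob B' \<Longrightarrow> mate b' \<in> Hom B (FOb u (FOb v (FOb r' b'))) (FOb w b')"
  using B.comp_in[OF \<alpha>_in w.ar_in[OF adj'.counit_in]] adj'.right.ob_in by (simp add: mate_def)

lemma vr'_in: "b' \<in> Ob B' \<Longrightarrow> FOb v (FOb r' b') \<in> Ob A"
  using v.ob_in adj'.right.ob_in by simp

lemma base_change_eq:
  assumes b': "b' \<in> Ob B'"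
  shows "c b' = Comp A (FAr r (mate b')) (\<eta> (FOb v (FOb r' b')))"
proof -
  have r'b': "FOb r' b' \<in> Ob A'"
    using adj'.right.ob_in b' .
  note \<epsilon>'_in = w.ar_in[OF adj'.counit_in[OF b']]
  show ?thesis
    using A.comp_assoc[OF adj.unit_in[OF vr'_in[OF b']] adj.right.ar_in[OF \<alpha>_in[OF r'b']]
        adj.right.ar_in[OF \<epsilon>'_in]]
      adj.right.map_comp[OF \<alpha>_in[OF r'b'] \<epsilon>'_in]
    by (simp add: base_change_def vcomp_def whisker_l_def whisker_r_def comp_fun_def mate_def)
qed

lemma base_change_in: "b' \<in> Ob B' \<Longrightarrow> c b' \<in> Hom A (FOb v (FOb r' b')) (FOb r (FOb w b'))"
  using adj.transpose_in[OF vr'_in mate_in] by (simp add: base_change_eq)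

lemma counit_base_change:
  "b' \<in> Ob B' \<Longrightarrow> Comp B (\<epsilon> (FOb w b')) (FAr u (c b')) = mate b'"
  using adj.counit_transpose[OF vr'_in mate_in] by (simp add: base_change_eq)

text \<open>Arrows into \<open>r (w b')\<close> are compared through their transposes, here
  \<open>mate b'\<close> after \<open>u(k)\<close> and \<open>g\<close>. Invertibility of the base
  change, a matter of \<open>A\<close>, becomes unique solvability of equations in \<open>B\<close>,
  where the condition on triples is stated.\<close>

lemma base_change_comp_eq_iff:
  assumes b': "b' \<in> Ob B'" and k: "k \<in> Hom A a (FOb v (FOb r' b'))"
    and g: "g \<in> Hom B (FOb u a) (FOb w b')"
  shows "Comp A (c b') k = Comp A (FAr r g) (\<eta> a) \<longleftrightarrow> Comp B (mate b') (FAr u k) = g"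
proof -
  have a: "a \<in> Ob A"
    using A.Hom_ob[OF k] ..
  have wb': "FOb w b' \<in> Ob B"
    using w.ob_in b' .
  note cb' = base_change_in[OF b']
  have "Comp B (\<epsilon> (FOb w b')) (FAr u (Comp A (c b') k)) = Comp B (mate b') (FAr u k)"
    using u.map_comp[OF k cb'] B.comp_assoc[OF u.ar_in[OF k] u.ar_in[OF cb'] adj.counit_in[OF wb']]
      counit_base_change[OF b'] by simp
  then show ?thesis
    using adj.transpose_unique[OF wb' A.comp_in[OF k cb']] adj.counit_transpose[OF a g] by metis
qed

lemma nat_trans_base_change: "nat_trans B' A (v \<cdot>\<^sub>F r') (r \<cdot>\<^sub>F w) c"
proof (intro nat_trans.intro nat_trans_axioms.intro)
  show "cat_functor B' A (v \<cdot>\<^sub>F r')" "cat_functor B' A (r \<cdot>\<^sub>F w)"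
    using cat_functor_comp_fun adj'.right.cat_functor_axioms v.cat_functor_axioms
      w.cat_functor_axioms adj.right.cat_functor_axioms by blast+
  fix x assume "x \<in> Ob B'"
  then show "c x \<in> Hom A (FOb (v \<cdot>\<^sub>F r') x) (FOb (r \<cdot>\<^sub>F w) x)"
    using base_change_in by (simp add: comp_fun_def)
next
  fix h x y assume h: "h \<in> Hom B' x y"
  then have x: "x \<in> Ob B'" and y: "y \<in> Ob B'"
    using B'.Hom_ob by auto
  have r'x: "FOb r' x \<in> Ob A'" and r'y: "FOb r' y \<in> Ob A'" and wx: "FOb w x \<in> Ob B"
    using adj'.right.ob_in w.ob_in x y by auto
  note r'h = adj'.right.ar_in[OF h]
  note vr'h = v.ar_in[OF r'h] and wh = w.ar_in[OF h]
  \<comment> \<open>Naturality is checked on the transposes, where it is naturality of \<alpha>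
    followed by that of \<epsilon>'.\<close>
  have "Comp B (mate y) (FAr u (FAr v (FAr r' h))) =
      Comp B (FAr w (\<epsilon>' y)) (Comp B (FAr w (FAr u' (FAr r' h))) (\<alpha> (FOb r' x)))"
    using B.comp_assoc[OF u.ar_in[OF vr'h] \<alpha>_in[OF r'y] w.ar_in[OF adj'.counit_in[OF y]]]
      \<alpha>.naturality[OF r'h] by (simp add: mate_def comp_fun_def)
  also have "\<dots> = Comp B (FAr w (Comp B' h (\<epsilon>' x))) (\<alpha> (FOb r' x))"
    using B.comp_assoc[OF \<alpha>_in[OF r'x] w.ar_in[OF u'.ar_in[OF r'h]] w.ar_in[OF adj'.counit_in[OF y]]]
      w.map_comp[OF u'.ar_in[OF r'h] adj'.counit_in[OF y]] adj'.counit_nat[OF h] by simp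
  also have "\<dots> = Comp B (FAr w h) (mate x)"
    using B.comp_assoc[OF \<alpha>_in[OF r'x] w.ar_in[OF adj'.counit_in[OF x]] wh]
      w.map_comp[OF adj'.counit_in[OF x] h] by (simp add: mate_def)
  finally have "Comp A (c y) (FAr v (FAr r' h)) =
      Comp A (FAr r (Comp B (FAr w h) (mate x))) (\<eta> (FOb v (FOb r' x)))"
    using base_change_comp_eq_iff[OF y vr'h B.comp_in[OF mate_in[OF x] wh]] by simp
  also have "\<dots> = Comp A (FAr r (FAr w h)) (c x)"
    using adj.right.map_comp[OF mate_in[OF x] wh] base_change_eq[OF x]
      A.comp_assoc[OF adj.unit_in[OF vr'_in[OF x]] adj.right.ar_in[OF mate_in[OF x]]
        adj.right.ar_in[OF wh]] by simp
  finally show "Comp A (c y) (FAr (v \<cdot>\<^sub>F r') h) = Comp A (FAr (r \<cdot>\<^sub>F w) h) (c x)"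
    by (simp add: comp_fun_def)
qed

text \<open>
  The category of triples over \<open>(a, b', g)\<close> is the disjoint union, over the lifts \<open>k\<close> of \<open>g\<close>
  below, of categories with terminal object \<open>(r' b', k, \<epsilon>'\<^bsub>b'\<^esub>)\<close>; \<open>lift_of\<close> gives the summand
  of a triple.
\<close>

definition lifts where
  "lifts a b' g = {k \<in> Hom A a (FOb v (FOb r' b')). Comp B (mate b') (FAr u k) = g}"

definition lift_of where
  "lift_of = (\<lambda>(a', f, g'). Comp A (FAr v (Comp A' (FAr r' g') (\<eta>' a'))) f)"

lemma lift_in_fibre:
  assumes b': "b' \<in> Ob B'" and k: "k \<in> lifts a b' g"
  shows "(FOb r' b', k, \<epsilon>' b') \<in> Ob (fibre a b' g)"
proof -
  have r'b': "FOb r' b' \<in> Ob A'" and k: "k \<in> Hom A a (FOb v (FOb r' b'))"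
    and g: "Comp B (mate b') (FAr u k) = g"
    using adj'.right.ob_in b' k by (auto simp: lifts_def)
  note \<epsilon>'b' = adj'.counit_in[OF b']
  show ?thesis
    using r'b' k \<epsilon>'b' g B.comp_assoc[OF u.ar_in[OF k] \<alpha>_in[OF r'b'] w.ar_in[OF \<epsilon>'b']]
    by (simp add: Ob_fibre_cat mate_def)
qed

lemma lift_of_lift:
  assumes b': "b' \<in> Ob B'" and k: "k \<in> lifts a b' g"
  shows "lift_of (FOb r' b', k, \<epsilon>' b') = k"
proof -
  have "k \<in> Hom A a (FOb v (FOb r' b'))"
    using k by (simp add: lifts_def)
  then show ?thesis
    using adj'.triangle_right[OF b'] v.map_ide[OF adj'.right.ob_in[OF b']] A.comp_ide_left
    by (simp add: lift_of_def)
qed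

text \<open>Let \<open>h\<close> be the transpose of \<open>g'\<close>. Naturality of \<alpha> moves
  \<open>v(h)\<close> across the square, and \<epsilon>' after \<open>u'(h)\<close> gives back
  \<open>g'\<close>; the lifting equation for \<open>v(h) f\<close> is then the condition defining
  the triple.\<close>

lemma lift_of_in:
  assumes b': "b' \<in> Ob B'" and s: "s \<in> Ob (fibre a b' g)"
  shows "lift_of s \<in> lifts a b' g"
proof -
  obtain a' f g' where s: "s = (a', f, g')" and a': "a' \<in> Ob A'" and f: "f \<in> Hom A a (FOb v a')"
    and g': "g' \<in> Hom B' (FOb u' a') b'"
    and g: "Comp B (FAr w g') (Comp B (\<alpha> a') (FAr u f)) = g"
    using s by (auto simp: Ob_fibre_cat)
  define h where "h = Comp A' (FAr r' g') (\<eta>' a')"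
  have h: "h \<in> Hom A' a' (FOb r' b')" and \<epsilon>'h: "Comp B' (\<epsilon>' b') (FAr u' h) = g'"
    using adj'.transpose_in[OF a' g'] adj'.counit_transpose[OF a' g'] by (auto simp: h_def)
  note vhf = A.comp_in[OF f v.ar_in[OF h]]
  have r'b': "FOb r' b' \<in> Ob A'"
    using adj'.right.ob_in b' .
  note \<epsilon>'b' = adj'.counit_in[OF b'] and \<alpha>f = component_under[OF a' f]
  have "Comp B (mate b') (FAr u (Comp A (FAr v h) f)) =
      Comp B (FAr w (\<epsilon>' b')) (Comp B (FAr w (FAr u' h)) (Comp B (\<alpha> a') (FAr u f)))"
    using B.comp_assoc[OF u.ar_in[OF vhf] \<alpha>_in[OF r'b'] w.ar_in[OF \<epsilon>'b']]
      component_natural[OF f h] by (simp add: mate_def)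
  also have "\<dots> = g"
    using B.comp_assoc[OF \<alpha>f w.ar_in[OF u'.ar_in[OF h]] w.ar_in[OF \<epsilon>'b']]
      w.map_comp[OF u'.ar_in[OF h] \<epsilon>'b'] \<epsilon>'h g by simp
  finally show ?thesis
    using vhf by (simp add: lifts_def lift_of_def s h_def)
qed

text \<open>Transposing \<open>g2 u'(h') = g1\<close> shows that the transpose of \<open>g1\<close>
  is that of \<open>g2\<close> after \<open>h'\<close>; once \<open>v\<close> is applied,
  \<open>v(h') f1 = f2\<close> absorbs \<open>h'\<close>. Hence \<open>lift_of\<close> is constant
  on connected components.\<close>

lemma lift_of_arrow:
  assumes "h \<in> Hom (fibre a b' g) s t"
  shows "lift_of s = lift_of t"
proof -
  obtain a1 f1 g1 a2 f2 g2 h' where s: "s = (a1, f1, g1)" and t: "t = (a2, f2, g2)"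
    and ob: "s \<in> Ob (fibre a b' g)" "t \<in> Ob (fibre a b' g)" and h': "fibre_arrow s t h'"
    using assms by (cases s; cases t) (auto simp: Hom_fibre)
  have a1: "a1 \<in> Ob A'" and a2: "a2 \<in> Ob A'" and f1: "f1 \<in> Hom A a (FOb v a1)"
    and g1: "g1 \<in> Hom B' (FOb u' a1) b'" and g2: "g2 \<in> Hom B' (FOb u' a2) b'"
    and h: "h' \<in> Hom A' a1 a2" and vh: "Comp A (FAr v h') f1 = f2"
    and uh: "Comp B' g2 (FAr u' h') = g1"
    using ob h' by (auto simp: s t Ob_fibre_cat fibre_arrow_def)
  note k2 = adj'.transpose_in[OF a2 g2]
  have b': "b' \<in> Ob B'"
    using B'.Hom_ob[OF g1] ..
  have "Comp B' (\<epsilon>' b') (FAr u' (Comp A' (Comp A' (FAr r' g2) (\<eta>' a2)) h')) = g1"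
    using u'.map_comp[OF h k2] uh adj'.counit_transpose[OF a2 g2]
      B'.comp_assoc[OF u'.ar_in[OF h] u'.ar_in[OF k2] adj'.counit_in[OF b']] by simp
  then have "Comp A' (FAr r' g1) (\<eta>' a1) = Comp A' (Comp A' (FAr r' g2) (\<eta>' a2)) h'"
    using adj'.transpose_unique[OF b' A'.comp_in[OF h k2]] by simp
  then show ?thesis
    using v.map_comp[OF h k2] A.comp_assoc[OF f1 v.ar_in[OF h] v.ar_in[OF k2]] vh
    by (simp add: lift_of_def s t)
qed

text \<open>Compatibility with the third components forces an arrow into
  \<open>(r' b', k, \<epsilon>' b')\<close> to be the transpose of \<open>g'\<close>. Compatibility
  with the second components then reads \<open>lift_of s = k\<close>, which is automatic when there
  is a single lift.\<close>

lemma has_terminal_object_fibre: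
  assumes b': "b' \<in> Ob B'" and lifts: "lifts a b' g = {k}"
  shows "has_terminal_object (fibre a b' g)"
  unfolding has_terminal_object_fibre_iff
proof (intro bexI ballI)
  show "(FOb r' b', k, \<epsilon>' b') \<in> Ob (fibre a b' g)"
    using lift_in_fibre[OF b', of k a g] lifts by simp
  fix s assume s: "s \<in> Ob (fibre a b' g)"
  obtain a' f g' where s_eq: "s = (a', f, g')" and a': "a' \<in> Ob A'" and f: "f \<in> Hom A a (FOb v a')"
    and g': "g' \<in> Hom B' (FOb u' a') b'"
    using s by (auto simp: Ob_fibre_cat)
  have k: "Comp A (FAr v (Comp A' (FAr r' g') (\<eta>' a'))) f = k"
    using lift_of_in[OF b' s] lifts by (simp add: lift_of_def s_eq)
  show "\<exists>!h. fibre_arrow s (FOb r' b', k, \<epsilon>' b') h"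
  proof (rule ex1I)
    show "fibre_arrow s (FOb r' b', k, \<epsilon>' b') (Comp A' (FAr r' g') (\<eta>' a'))"
      using k adj'.transpose_in[OF a' g'] adj'.counit_transpose[OF a' g']
      by (simp add: fibre_arrow_def s_eq)
    fix h assume "fibre_arrow s (FOb r' b', k, \<epsilon>' b') h"
    then show "h = Comp A' (FAr r' g') (\<eta>' a')"
      by (intro adj'.transpose_unique[OF b']) (simp_all add: fibre_arrow_def s_eq)
  qed
qed

text \<open>Every lift is the value of \<open>lift_of\<close> at some triple, and connectedness
  makes \<open>lift_of\<close> constant. Existence of a lift comes from the nonemptiness contained
  in the hypothesis.\<close>

lemma lifts_singleton_of_connected:
  assumes b': "b' \<in> Ob B'" and conn: "W_zero (fibre a b' g) terminal_cat to_terminal"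
  shows "\<exists>k. lifts a b' g = {k}"
proof -
  obtain s where s: "s \<in> Ob (fibre a b' g)"
    and st: "\<And>t. t \<in> Ob (fibre a b' g) \<Longrightarrow> (s, t) \<in> conn_rel (fibre a b' g)"
    using iffD1[OF W_zero_terminal_iff[OF category_fibre_cat] conn] by (elim bexE) simp
  have *: "k = lift_of s" if k: "k \<in> lifts a b' g" for k
  proof -
    have "lift_of s = lift_of (FOb r' b', k, \<epsilon>' b')"
      using st[OF lift_in_fibre[OF b' k]] by (rule conn_rel_invariant) (rule lift_of_arrow)
    then show ?thesis
      using lift_of_lift[OF b' k] by simp
  qed
  have "lifts a b' g = {lift_of s}"
  proof (intro subset_antisym subsetI)
    show "x \<in> {lift_of s}" if "x \<in> lifts a b' g" for x
      using *[OF that] by simp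
    show "x \<in> lifts a b' g" if "x \<in> {lift_of s}" for x
      using lift_of_in[OF b' s] that by simp
  qed
  then show ?thesis ..
qed

lemma lifts_singleton_of_iso:
  assumes iso: "nat_iso B' A (v \<cdot>\<^sub>F r') (r \<cdot>\<^sub>F w) c"
    and a: "a \<in> Ob A" and b': "b' \<in> Ob B'" and g: "g \<in> Hom B (FOb u a) (FOb w b')"
  shows "\<exists>k. lifts a b' g = {k}"
proof -
  obtain \<sigma> where \<sigma>: "nat_trans B' A (r \<cdot>\<^sub>F w) (v \<cdot>\<^sub>F r') \<sigma>"
    and \<sigma>c: "Comp A (\<sigma> b') (c b') = Ide A (FOb v (FOb r' b'))"
    and c\<sigma>: "Comp A (c b') (\<sigma> b') = Ide A (FOb r (FOb w b'))"
    using iso b' by (auto simp: nat_iso_def vcomp_def id_nat_def comp_fun_def)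
  have \<sigma>b': "\<sigma> b' \<in> Hom A (FOb r (FOb w b')) (FOb v (FOb r' b'))"
    using nat_trans.component_in[OF \<sigma> b'] by (simp add: comp_fun_def)
  note cb' = base_change_in[OF b'] and rg = adj.transpose_in[OF a g]
  define k where "k = Comp A (\<sigma> b') (Comp A (FAr r g) (\<eta> a))"
  have k: "k \<in> Hom A a (FOb v (FOb r' b'))"
    unfolding k_def using A.comp_in[OF rg \<sigma>b'] .
  have "Comp A (c b') k = Comp A (FAr r g) (\<eta> a)"
    using A.comp_assoc[OF rg \<sigma>b' cb'] c\<sigma> A.comp_ide_left[OF rg] by (simp add: k_def)
  then have "k \<in> lifts a b' g"
    using base_change_comp_eq_iff[OF b' k g] k by (simp add: lifts_def)
  moreover have "l \<in> {k}" if "l \<in> lifts a b' g" for l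
  proof -
    have l: "l \<in> Hom A a (FOb v (FOb r' b'))" and "Comp B (mate b') (FAr u l) = g"
      using that by (simp_all add: lifts_def)
    then have "Comp A (c b') l = Comp A (FAr r g) (\<eta> a)"
      using base_change_comp_eq_iff[OF b' l g] by simp
    then show ?thesis
      using A.comp_assoc[OF l cb' \<sigma>b'] \<sigma>c A.comp_ide_left[OF l] by (simp add: k_def)
  qed
  ultimately have "lifts a b' g = {k}"
    by blast
  then show ?thesis ..
qed

lemma nat_iso_base_change:
  assumes lifts: "\<And>a b' g. \<lbrakk>a \<in> Ob A; b' \<in> Ob B'; g \<in> Hom B (FOb u a) (FOb w b')\<rbrakk>
    \<Longrightarrow> \<exists>k. lifts a b' g = {k}"
  shows "nat_iso B' A (v \<cdot>\<^sub>F r') (r \<cdot>\<^sub>F w) c"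
proof (rule nat_isoI[OF nat_trans_base_change])
  fix b' assume b': "b' \<in> Ob B'"
  have wb': "FOb w b' \<in> Ob B" and rwb': "FOb r (FOb w b') \<in> Ob A"
    using w.ob_in adj.right.ob_in b' by auto
  note cb' = base_change_in[OF b'] and \<epsilon>wb' = adj.counit_in[OF wb']
  \<comment> \<open>The generic instance: \<epsilon> is the transpose of the identity of
    \<open>r (w b')\<close>, so its lift is a right inverse of \<open>c b'\<close>.\<close>
  obtain s where "lifts (FOb r (FOb w b')) b' (\<epsilon> (FOb w b')) = {s}"
    using lifts[OF rwb' b' \<epsilon>wb'] ..
  then have s: "s \<in> Hom A (FOb r (FOb w b')) (FOb v (FOb r' b'))"
    and ms: "Comp B (mate b') (FAr u s) = \<epsilon> (FOb w b')"
    unfolding lifts_def by auto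
  have cs: "Comp A (c b') s = Ide A (FOb r (FOb w b'))"
    using base_change_comp_eq_iff[OF b' s \<epsilon>wb'] ms adj.triangle_right[OF wb'] by simp
  \<comment> \<open>The mate is the transpose of \<open>c b'\<close> itself. Both \<open>s\<close>
    after \<open>c b'\<close> and the identity lift it, hence they coincide.\<close>
  have sc: "Comp A s (c b') \<in> lifts (FOb v (FOb r' b')) b' (mate b')"
    using A.comp_in[OF cb' s] B.comp_assoc[OF u.ar_in[OF cb'] u.ar_in[OF s] mate_in[OF b']]
      u.map_comp[OF cb' s] ms counit_base_change[OF b'] by (simp add: lifts_def)
  have "Ide A (FOb v (FOb r' b')) \<in> lifts (FOb v (FOb r' b')) b' (mate b')"
    using A.ide_in[OF vr'_in[OF b']] u.map_ide[OF vr'_in[OF b']] B.comp_ide_right[OF mate_in[OF b']]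
    by (simp add: lifts_def)
  with sc have "Comp A s (c b') = Ide A (FOb v (FOb r' b'))"
    using lifts[OF vr'_in[OF b'] b' mate_in[OF b']] by (metis singletonD)
  with s cs show "\<exists>s\<in>Hom A (FOb (r \<cdot>\<^sub>F w) b') (FOb (v \<cdot>\<^sub>F r') b').
      Comp A s (c b') = Ide A (FOb (v \<cdot>\<^sub>F r') b') \<and> Comp A (c b') s = Ide A (FOb (r \<cdot>\<^sub>F w) b')"
    by (auto simp: comp_fun_def)
qed

end

section \<open>Homotopy classes in contractible spaces\<close>

lemma cube_01: "z \<in> topspace (cube n) \<Longrightarrow> i < n \<Longrightarrow> 0 \<le> z i \<and> z i \<le> 1"
  by (auto simp: cube_def PiE_iff)

lemma cube_maps_const: "x \<in> topspace X \<Longrightarrow> (\<lambda>_. x) \<in> cube_maps n X x"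
  by (simp add: cube_maps_def)

lemma cube_homotopic_iff:
  "(f, g) \<in> cube_homotopic n X x \<longleftrightarrow>
    (\<exists>h. continuous_map (prod_topology (top_of_set {0..1::real}) (cube n)) X h \<and>
       (\<forall>z\<in>topspace (cube n). h (0, z) = f z) \<and> (\<forall>z\<in>topspace (cube n). h (1, z) = g z) \<and>
       (\<forall>t\<in>{0..1}. \<forall>z\<in>cube_boundary n. h (t, z) = x))"
proof -
  \<comment> \<open>Unfolding \<open>homotopic_with\<close> requires that the property depend only
    on values on the cube.\<close>
  have *: "(\<forall>z\<in>cube_boundary n. h z = x) \<longleftrightarrow> (\<forall>z\<in>cube_boundary n. k z = x)"
    if "\<And>z. z \<in> topspace (cube n) \<Longrightarrow> h z = k z" for h k :: "(nat \<Rightarrow> real) \<Rightarrow> 'a"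
    using that unfolding cube_boundary_def by (metis (no_types, lifting) mem_Collect_eq)
  show ?thesis
    unfolding cube_homotopic_def mem_Collect_eq case_prod_conv
    by (rule homotopic_with) (rule *)
qed

lemma cube_homotopic_sym: "(f, g) \<in> cube_homotopic n X x \<Longrightarrow> (g, f) \<in> cube_homotopic n X x"
  by (simp add: cube_homotopic_def homotopic_with_symD)

lemma cube_homotopic_trans:
  "\<lbrakk>(f, g) \<in> cube_homotopic n X x; (g, h) \<in> cube_homotopic n X x\<rbrakk> \<Longrightarrow> (f, h) \<in> cube_homotopic n X x"
  unfolding cube_homotopic_def mem_Collect_eq case_prod_conv by (rule homotopic_with_trans)

lemma cube_homotopic_in_cube_maps: "(f, g) \<in> cube_homotopic n X x \<Longrightarrow> g \<in> cube_maps n X x"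
  unfolding cube_homotopic_def cube_maps_def mem_Collect_eq case_prod_conv
  using homotopic_with_imp_continuous_maps homotopic_with_imp_property by (intro conjI) blast+

text \<open>
  \<open>cube_stretch s\<close> dilates the cube by \<open>1 + 2 s\<close> about its centre and clamps the result to the
  cube; for \<open>s = 1\<close> it collapses everything outside the middle third onto the boundary.
\<close>

definition cube_stretch :: "nat \<Rightarrow> real \<Rightarrow> (nat \<Rightarrow> real) \<Rightarrow> nat \<Rightarrow> real" where
  "cube_stretch n s z = restrict (\<lambda>i. max 0 (min 1 ((1 + 2 * s) * z i - s))) {..<n}"

text \<open>A cutoff, 0 on the boundary and 1 on the middle third. The slope 3 matches the dilation
  \<open>1 + 2 * 1\<close> of \<open>cube_stretch n 1\<close>, so that the cutoff falls below 1 only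
  at points which the stretch sends to the boundary.\<close>

definition cube_bump :: "nat \<Rightarrow> (nat \<Rightarrow> real) \<Rightarrow> real" where
  "cube_bump n z = (\<Prod>i<n. min 1 (3 * min (z i) (1 - z i)))"

lemma continuous_map_cube_coordinate:
  assumes "i < n"
  shows "continuous_map (cube n) euclideanreal (\<lambda>z. z i)"
  unfolding cube_def
  using continuous_map_product_projection[of i "{..<n}" "\<lambda>_. top_of_set {0..1::real}"] assms
  by (simp add: continuous_map_in_subtopology)

lemma continuous_map_cube_stretch:
  "continuous_map (prod_topology (top_of_set {0..1}) (cube n)) (cube n) (\<lambda>p. cube_stretch n (fst p) (snd p))"
    (is "continuous_map ?P _ _")
proof -
  have "continuous_map ?P (top_of_set {0..1}) (\<lambda>p. cube_stretch n (fst p) (snd p) i)" if "i < n" for i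
  proof -
    have "continuous_map ?P euclideanreal fst"
      using continuous_map_fst continuous_map_into_fulltopology by blast
    moreover have "continuous_map ?P euclideanreal (\<lambda>p. snd p i)"
      using continuous_map_compose[OF continuous_map_snd continuous_map_cube_coordinate[OF that]]
      by (simp only: o_def)
    ultimately have "continuous_map ?P euclideanreal (\<lambda>p. max 0 (min 1 ((1 + 2 * fst p) * snd p i - fst p)))"
      by (intro continuous_map_real_max continuous_map_real_min continuous_map_diff
          continuous_map_real_mult continuous_map_add) simp_all
    then show ?thesis
      using that by (simp add: continuous_map_in_subtopology cube_stretch_def)
  qed
  moreover have "(\<lambda>p. cube_stretch n (fst p) (snd p)) ` topspace ?P \<subseteq> extensional {..<n}"
    by (auto simp: cube_stretch_def)
  ultimately show ?thesis
    unfolding cube_def[of n] continuous_map_componentwise by simp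
qed

lemma cube_stretch_boundary:
  assumes "z \<in> cube_boundary n" "0 \<le> s" "s \<le> 1"
  shows "cube_stretch n s z \<in> cube_boundary n"
proof -
  obtain i where "i < n" "z i = 0 \<or> z i = 1"
    using assms(1) by (auto simp: cube_boundary_def)
  then have "cube_stretch n s z i = 0 \<or> cube_stretch n s z i = 1"
    using assms(2,3) by (auto simp: cube_stretch_def)
  then show ?thesis
    using \<open>i < n\<close> by (auto simp: cube_boundary_def cube_stretch_def cube_def)
qed

lemma cube_stretch_0: "z \<in> topspace (cube n) \<Longrightarrow> cube_stretch n 0 z = z"
  by (auto simp: cube_stretch_def cube_def PiE_iff fun_eq_iff extensional_def restrict_def)

lemma continuous_map_cube_bump: "continuous_map (cube n) (top_of_set {0..1}) (cube_bump n)"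
  unfolding continuous_map_in_subtopology
proof
  show "continuous_map (cube n) euclideanreal (cube_bump n)"
    unfolding cube_bump_def
    by (intro continuous_intros continuous_map_cube_coordinate) auto
  show "cube_bump n \<in> topspace (cube n) \<rightarrow> {0..1}"
    using cube_01 by (auto simp: cube_bump_def intro!: prod_nonneg prod_le_1) 
qed

lemma cube_bump_boundary: "z \<in> cube_boundary n \<Longrightarrow> cube_bump n z = 0"
  unfolding cube_boundary_def cube_bump_def by (force intro: prod_zero)

text \<open>If no coordinate of the stretched point is 0 or 1, nothing was clamped; all coordinates
  of \<open>z\<close> then lie strictly between 1/3 and 2/3, where each factor of the bump is
  1.\<close>

lemma cube_bump_or_boundary:
  assumes "z \<in> topspace (cube n)"
  shows "cube_bump n z = 1 \<or> cube_stretch n 1 z \<in> cube_boundary n"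
proof (rule disjCI)
  assume out: "cube_stretch n 1 z \<notin> cube_boundary n"
  have "cube_stretch n 1 z \<in> topspace (cube n)"
    by (simp add: cube_def cube_stretch_def)
  then have "cube_stretch n 1 z i \<noteq> 0 \<and> cube_stretch n 1 z i \<noteq> 1" if "i < n" for i
    using out that unfolding cube_boundary_def by blast
  then have *: "max 0 (min 1 (3 * z i - 1)) \<noteq> 0 \<and> max 0 (min 1 (3 * z i - 1)) \<noteq> 1" if "i < n" for i
    using that by (simp add: cube_stretch_def)
  have **: "1 / 3 < z i \<and> z i < 2 / 3" if "i < n" for i
    using *[OF that] by (cases "3 * z i - 1 \<le> 0"; cases "1 \<le> 3 * z i - 1") (auto simp: max_def min_def split: if_splits)
  have "min 1 (3 * min (z i) (1 - z i)) = 1" if "i < n" for i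
    using **[OF that] by (auto simp: min_def)
  then show "cube_bump n z = 1"
    unfolding cube_bump_def by (intro prod.neutral) simp
qed

lemma cube_maps_stretch:
  assumes "f \<in> cube_maps n X x"
  shows "(f, f \<circ> cube_stretch n 1) \<in> cube_homotopic n X x"
  unfolding cube_homotopic_iff
proof (intro exI conjI)
  show "continuous_map (prod_topology (top_of_set {0..1}) (cube n)) X (f \<circ> (\<lambda>p. cube_stretch n (fst p) (snd p)))"
    using assms continuous_map_cube_stretch by (auto simp: cube_maps_def intro: continuous_map_compose)
qed (use assms cube_stretch_boundary in \<open>auto simp: cube_maps_def cube_stretch_0\<close>)

text \<open>
  The track of \<open>x\<close> under the contraction \<open>H\<close> is inserted into the collar between the boundary and
  the middle third of the cube, so that the homotopy \<open>H\<close> takes place relative to the boundary; the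
  final map depends on \<open>x\<close> but no longer on \<open>f\<close>.
\<close>

lemma cube_maps_contract:
  assumes H: "continuous_map (prod_topology (top_of_set {0..1}) X) X H"
    and H0: "\<And>y. y \<in> topspace X \<Longrightarrow> H (0, y) = y" and H1: "\<And>y. y \<in> topspace X \<Longrightarrow> H (1, y) = p"
    and x: "x \<in> topspace X" and f: "f \<in> cube_maps n X x"
  shows "(f \<circ> cube_stretch n 1, \<lambda>z. H (cube_bump n z, x)) \<in> cube_homotopic n X x"
  unfolding cube_homotopic_iff
proof (intro exI conjI ballI)
  let ?I = "top_of_set {0..1::real}"
  \<comment> \<open>The contraction runs for time \<open>t * cube_bump n z\<close>, which is 0 on
    the boundary. At \<open>t = 1\<close> either the bump is 1 and \<open>H\<close> has reached
    \<open>p\<close> whatever \<open>f\<close> is, or the stretched point is on the boundary, where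
    \<open>f\<close> takes the value \<open>x\<close>.\<close>
  let ?h = "\<lambda>q. H (fst q * cube_bump n (snd q), f (cube_stretch n 1 (snd q)))"
  have cube1: "continuous_map (cube n) (cube n) (cube_stretch n 1)"
    using continuous_map_o_Pair[OF continuous_map_cube_stretch, of 1] by (simp add: o_def)
  have fc: "continuous_map (cube n) X f" and fx: "\<And>z. z \<in> cube_boundary n \<Longrightarrow> f z = x"
    using f by (auto simp: cube_maps_def)
  have "continuous_map (prod_topology ?I (cube n)) ?I (\<lambda>q. fst q * cube_bump n (snd q))"
  proof -
    have "continuous_map (prod_topology ?I (cube n)) ?I (\<lambda>q. cube_bump n (snd q))"
      using continuous_map_compose[OF continuous_map_snd continuous_map_cube_bump]
      by (simp add: o_def)
    then show ?thesis
      using continuous_map_fst[of ?I "cube n"] unfolding continuous_map_in_subtopology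
      by (auto intro!: continuous_map_real_mult simp: Pi_iff mult_le_one)
  qed
  moreover have "continuous_map (prod_topology ?I (cube n)) X (\<lambda>q. f (cube_stretch n 1 (snd q)))"
    using continuous_map_compose[OF continuous_map_compose[OF continuous_map_snd cube1] fc]
    by (simp add: o_def)
  ultimately show "continuous_map (prod_topology ?I (cube n)) X ?h"
    using continuous_map_compose[OF continuous_map_pairedI H] by (simp add: o_def)
  show "?h (0, z) = (f \<circ> cube_stretch n 1) z" if z: "z \<in> topspace (cube n)" for z
    using continuous_map_compose[OF cube1 fc] z by (simp add: H0 continuous_map_def Pi_iff)
  show "?h (1, z) = H (cube_bump n z, x)" if z: "z \<in> topspace (cube n)" for z
  proof (cases "cube_bump n z = 1")
    case True
    have "f (cube_stretch n 1 z) \<in> topspace X"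
      using continuous_map_compose[OF cube1 fc] z by (simp add: continuous_map_def Pi_iff)
    then show ?thesis
      using True H1 x by simp
  next
    case False
    then show ?thesis
      using cube_bump_or_boundary[OF z] fx by simp
  qed
  show "?h (t, z) = x" if "t \<in> {0..1}" "z \<in> cube_boundary n" for t z
    using that x fx cube_stretch_boundary[of z n 1] by (simp add: cube_bump_boundary H0)
qed

lemma homotopy_classes_contractible:
  assumes X: "contractible_space X" and x: "x \<in> topspace X"
  shows "homotopy_classes n X x = {cube_maps n X x}"
proof -
  obtain p H where H: "continuous_map (prod_topology (top_of_set {0..1::real}) X) X H"
    and H0: "\<And>y. H (0, y) = y" and H1: "\<And>y. H (1, y) = p"
    using X by (auto simp: contractible_space_def homotopic_with_def)
  have "(f, \<lambda>z. H (cube_bump n z, x)) \<in> cube_homotopic n X x" if "f \<in> cube_maps n X x" for f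
    using cube_homotopic_trans[OF cube_maps_stretch[OF that] cube_maps_contract[OF H H0 H1 x that]] .
  then have "(f, g) \<in> cube_homotopic n X x" if "f \<in> cube_maps n X x" "g \<in> cube_maps n X x" for f g
    using that cube_homotopic_trans cube_homotopic_sym by metis
  then have "cube_homotopic n X x `` {f} = cube_maps n X x" if "f \<in> cube_maps n X x" for f
    using that cube_homotopic_in_cube_maps by fast
  then show ?thesis
    using cube_maps_const[OF x] by (auto simp: homotopy_classes_def quotient_def)
qed

text \<open>Each map to be checked goes from a singleton to a singleton, so it suffices that the one
  class goes to the one class; for cube maps the constant map shows this. Without a point in
  \<open>X\<close> there would be no path component.\<close>

lemma weak_homotopy_equivalence_contractible:
  assumes X: "contractible_space X" "topspace X \<noteq> {}" and Y: "contractible_space Y"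
    and f: "continuous_map X Y f"
  shows "weak_homotopy_equivalence X Y f"
proof -
  obtain x where x: "x \<in> topspace X"
    using X(2) by blast
  have fY: "f x \<in> topspace Y" if "x \<in> topspace X" for x
    using f that by (auto simp: continuous_map_def)
  have pX: "path_components_of X = {topspace X}" and pY: "path_components_of Y = {topspace Y}"
    using X Y fY[OF x] contractible_imp_path_connected_space
    by (auto simp: path_components_of_eq_singleton)
  have comp: "path_component_of_set Y y = topspace Y" if "y \<in> topspace Y" for y
  proof -
    have "path_component_of_set Y y \<in> path_components_of Y"
      using that by (simp add: path_components_of_def)
    then show ?thesis
      by (simp add: pY)
  qed
  have "(\<Union>y\<in>topspace X. path_component_of_set Y (f y)) = topspace Y"
    using x fY comp by auto
  then have "bij_betw (\<lambda>K. \<Union>x\<in>K. path_component_of_set Y (f x)) (path_components_of X) (path_components_of Y)"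
    unfolding pX pY by (simp add: bij_betw_def)
  moreover have "bij_betw (\<lambda>K. cube_homotopic n Y (f y) `` ((\<circ>) f ` K))
      (homotopy_classes n X y) (homotopy_classes n Y (f y))" if y: "y \<in> topspace X" for n y
  proof -
    have "cube_homotopic n Y (f y) `` ((\<circ>) f ` cube_maps n X y) = cube_maps n Y (f y)"
    proof
      show "cube_homotopic n Y (f y) `` ((\<circ>) f ` cube_maps n X y) \<subseteq> cube_maps n Y (f y)"
        using cube_homotopic_in_cube_maps by fast
      have const: "(\<lambda>_. f y) \<in> cube_maps n Y (f y)"
        using cube_maps_const fY[OF y] .
      have "cube_homotopic n Y (f y) `` {\<lambda>_. f y} \<in> homotopy_classes n Y (f y)"
        using const by (simp add: homotopy_classes_def quotientI)
      then have "cube_homotopic n Y (f y) `` {\<lambda>_. f y} = cube_maps n Y (f y)"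
        using homotopy_classes_contractible[OF Y fY[OF y]] by simp
      moreover have "(\<lambda>_. f y) \<in> (\<circ>) f ` cube_maps n X y"
        using cube_maps_const[OF y] by (rule rev_image_eqI) (simp add: o_def)
      ultimately show "cube_maps n Y (f y) \<subseteq> cube_homotopic n Y (f y) `` ((\<circ>) f ` cube_maps n X y)"
        by blast
    qed
    then show ?thesis
      using homotopy_classes_contractible[OF X(1) y] homotopy_classes_contractible[OF Y fY[OF y]]
      by (simp add: bij_betw_def)
  qed
  ultimately show ?thesis
    using f by (simp add: weak_homotopy_equivalence_def)
qed

section \<open>Realizations and nerves\<close>

lemma simplex_map_in:
  assumes \<theta>: "\<theta> \<in> mono_maps m n" and t: "t \<in> standard_simplex m"
  shows "simplex_map m \<theta> t \<in> standard_simplex n"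
proof -
  have \<theta>_le: "\<theta> j \<le> n" if "j \<le> m" for j
    using \<theta> that by (auto simp: mono_maps_def)
  have t0: "0 \<le> t j" and t1: "(\<Sum>j\<le>m. t j) = 1" for j
    using t by (auto simp: standard_simplex_def)
  have "(\<Sum>i\<le>n. simplex_map m \<theta> t i) = (\<Sum>j\<le>m. t j)"
    using sum.group[of "{..m}" "{..n}" \<theta> t] \<theta>_le by (simp add: simplex_map_def image_subset_iff)
  moreover have "simplex_map m \<theta> t i \<le> 1" for i
    using sum_mono2[of "{..m}" "{j. j \<le> m \<and> \<theta> j = i}" t] t0 t1 by (auto simp: simplex_map_def)
  moreover have "simplex_map m \<theta> t i = 0" if "n < i" for i
  proof -
    have "{j. j \<le> m \<and> \<theta> j = i} = {}"
      using \<theta>_le that by fastforce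
    then show ?thesis
      by (simp only: simplex_map_def sum.empty)
  qed
  ultimately show ?thesis
    using t0 t1 by (simp add: standard_simplex_def simplex_map_def sum_nonneg)
qed

lemma topspace_prerealization:
  "topspace (prerealization X) = {(n, x, t). x \<in> Smp X n \<and> t \<in> standard_simplex n}"
  by (auto simp: prerealization_def topspace_standard_simplex)

lemma topspace_realization: "topspace (realization X) = glue_class X ` topspace (prerealization X)"
  by (simp add: realization_def topspace_quotient_topology)

lemma quotient_map_realization: "quotient_map (prerealization X) (realization X) (glue_class X)"
  by (simp add: realization_def quotient_map_quotient_topology)

lemma glue_class_eq_iff: "glue_class X p = glue_class X q \<longleftrightarrow> equivclp (glue X) p q"
proof
  assume "glue_class X p = glue_class X q"
  then have "q \<in> glue_class X p"
    by (simp add: glue_class_def)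
  then show "equivclp (glue X) p q"
    by (simp add: glue_class_def)
next
  assume "equivclp (glue X) p q"
  then show "glue_class X p = glue_class X q"
    unfolding glue_class_def by (blast intro: equivclp_trans equivclp_sym)
qed

lemma glue_class_act:
  "\<lbrakk>\<theta> \<in> mono_maps m n; x \<in> Smp X n; t \<in> standard_simplex m\<rbrakk>
    \<Longrightarrow> glue_class X (m, Act X m n \<theta> x, t) = glue_class X (n, x, simplex_map m \<theta> t)"
  unfolding glue_class_eq_iff by (rule r_into_equivclp) (auto simp: glue_def)

context simplicial_set
begin

lemma glue_in:
  "glue X p q \<Longrightarrow> p \<in> topspace (prerealization X) \<and> q \<in> topspace (prerealization X)"
  unfolding topspace_prerealization by (auto simp: glue_def act_in simplex_map_in)

text \<open>The equivalence is generated on the whole type of prepoints. Since \<open>glue\<close>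
  relates only points of the prerealization, the class of such a point never leaves it.\<close>

lemma glue_class_subset:
  assumes "K \<in> topspace (realization X)"
  shows "K \<subseteq> topspace (prerealization X)" "K \<noteq> {}"
proof -
  obtain p where p: "p \<in> topspace (prerealization X)" and K: "K = glue_class X p"
    using assms by (auto simp: topspace_realization)
  have "q \<in> topspace (prerealization X)" if "equivclp (glue X) p q" for q
    using equivclp_invariant[OF that, of "\<lambda>p. p \<in> topspace (prerealization X)"] glue_in p by blast
  then show "K \<subseteq> topspace (prerealization X)"
    by (auto simp: K glue_class_def)
  have "p \<in> K"
    by (simp add: K glue_class_def)
  then show "K \<noteq> {}"
    by blast
qed

text \<open>The preimage is saturated because \<open>Q\<close> is invariant under the operators, and
  in each summand it is a subset of the discrete factor times the whole simplex, hence open. Applied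
  to a property and to its negation, this splits the realization.\<close>

lemma openin_realization_component:
  assumes Q: "\<And>m n \<theta> x. \<lbrakk>\<theta> \<in> mono_maps m n; x \<in> Smp X n\<rbrakk> \<Longrightarrow> Q m (Act X m n \<theta> x) \<longleftrightarrow> Q n x"
  shows "openin (realization X) (glue_class X ` {(n, x, t). x \<in> Smp X n \<and> t \<in> standard_simplex n \<and> Q n x})"
    (is "openin _ (_ ` ?V)")
proof -
  have V: "?V \<subseteq> topspace (prerealization X)"
    by (auto simp: topspace_prerealization)
  have sat: "p \<in> ?V \<longleftrightarrow> q \<in> ?V" if "equivclp (glue X) p q" for p q
    using that by (rule equivclp_invariant) (auto simp: glue_def act_in simplex_map_in Q)
  have "{p \<in> topspace (prerealization X). glue_class X p \<in> glue_class X ` ?V} = ?V"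
  proof (rule subset_antisym; rule subsetI)
    fix p assume "p \<in> {p \<in> topspace (prerealization X). glue_class X p \<in> glue_class X ` ?V}"
    then obtain q where "glue_class X p = glue_class X q" "q \<in> ?V"
      by blast
    then show "p \<in> ?V"
      using sat unfolding glue_class_eq_iff by blast
  next
    fix p assume "p \<in> ?V"
    then show "p \<in> {p \<in> topspace (prerealization X). glue_class X p \<in> glue_class X ` ?V}"
      using V by blast
  qed
  moreover have "openin (prerealization X) ?V"
  proof -
    have "{(x, t). x \<in> Smp X n \<and> t \<in> standard_simplex n \<and> Q n x} = {x \<in> Smp X n. Q n x} \<times> standard_simplex n" for n
      by auto
    moreover have "openin (prod_topology (discrete_topology (Smp X n))
        (subtopology (powertop_real UNIV) (standard_simplex n))) ({x \<in> Smp X n. Q n x} \<times> standard_simplex n)" for n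
      using openin_topspace[of "subtopology (powertop_real UNIV) (standard_simplex n)"]
      by (simp add: openin_prod_Times_iff topspace_standard_simplex)
    ultimately show ?thesis
      using V by (simp add: prerealization_def openin_sum_topology case_prod_unfold)
  qed
  ultimately show ?thesis
    using V by (auto simp: realization_def openin_quotient_topology)
qed

end

text \<open>Continuity is local and the injections into a sum are open, so a product neighbourhood
  found in one summand is still one in the product with the whole sum.\<close>

lemma continuous_map_prod_sum_topology:
  assumes "\<And>i. i \<in> I \<Longrightarrow> continuous_map (prod_topology Z (X i)) Y (\<lambda>(z, x). f (z, i, x))"
  shows "continuous_map (prod_topology Z (sum_topology X I)) Y f"
  unfolding continuous_map_def
proof (intro conjI allI impI)
  show "f \<in> topspace (prod_topology Z (sum_topology X I)) \<rightarrow> topspace Y"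
    using assms by (auto simp: continuous_map_def Pi_iff)
  fix U assume U: "openin Y U"
  show "openin (prod_topology Z (sum_topology X I)) {p \<in> topspace (prod_topology Z (sum_topology X I)). f p \<in> U}"
    unfolding openin_prod_topology_alt
  proof (intro allI impI)
    fix z p assume "(z, p) \<in> {p \<in> topspace (prod_topology Z (sum_topology X I)). f p \<in> U}"
    then obtain i x where p: "p = (i, x)" and i: "i \<in> I" and x: "x \<in> topspace (X i)"
      and z: "z \<in> topspace Z" and f: "f (z, i, x) \<in> U"
      by auto
    define S where "S = {q \<in> topspace (prod_topology Z (X i)). (\<lambda>(z, x). f (z, i, x)) q \<in> U}"
    have "openin (prod_topology Z (X i)) S"
      using assms[OF i] U by (simp add: continuous_map_def S_def)
    moreover have "(z, x) \<in> S"
      using x z f by (simp add: S_def)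
    ultimately obtain V W where V: "openin Z V" "z \<in> V" and W: "openin (X i) W" "x \<in> W"
      and VW: "V \<times> W \<subseteq> S"
      unfolding openin_prod_topology_alt by metis
    have "openin (sum_topology X I) (Pair i ` W)"
      using open_map_component_injection[OF i] W(1) by (auto simp: open_map_def)
    moreover have "V \<times> Pair i ` W \<subseteq> {p \<in> topspace (prod_topology Z (sum_topology X I)). f p \<in> U}"
      using VW i by (auto simp: S_def)
    ultimately show "\<exists>V W. openin Z V \<and> openin (sum_topology X I) W \<and> z \<in> V \<and> p \<in> W \<and>
        V \<times> W \<subseteq> {p \<in> topspace (prod_topology Z (sum_topology X I)). f p \<in> U}"
      using V W(2) p by blast
  qed
qed

section \<open>Simplices of the nerve, and connectedness of its realization\<close>

lemma nerve_simplexI: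
  assumes "category C"
    and "\<And>i. i \<le> n \<Longrightarrow> ob i \<in> Ob C"
    and "\<And>i j. \<lbrakk>i \<le> j; j \<le> n\<rbrakk> \<Longrightarrow> ar i j \<in> Hom C (ob i) (ob j)"
    and "\<And>i. i \<le> n \<Longrightarrow> ar i i = Ide C (ob i)"
    and "\<And>i j k. \<lbrakk>i \<le> j; j \<le> k; k \<le> n\<rbrakk> \<Longrightarrow> ar i k = Comp C (ar j k) (ar i j)"
  shows "restrict_fun (ordinal_cat n) \<lparr>FOb = ob, FAr = \<lambda>(i, j). ar i j\<rparr> \<in> Smp (nerve C) n"
proof -
  have "cat_functor (ordinal_cat n) C \<lparr>FOb = ob, FAr = \<lambda>(i, j). ar i j\<rparr>"
  proof (intro cat_functor.intro cat_functor_axioms.intro category_ordinal_cat)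
    fix p q i j k assume "p \<in> Hom (ordinal_cat n) i j" "q \<in> Hom (ordinal_cat n) j k"
    then show "FAr \<lparr>FOb = ob, FAr = \<lambda>(i, j). ar i j\<rparr> (Comp (ordinal_cat n) q p) =
        Comp C (FAr \<lparr>FOb = ob, FAr = \<lambda>(i, j). ar i j\<rparr> q) (FAr \<lparr>FOb = ob, FAr = \<lambda>(i, j). ar i j\<rparr> p)"
      using assms(5)[of i j k] by (simp add: ordinal_cat_simps Hom_ordinal_cat)
  qed (use assms(1-4) in \<open>auto simp: ordinal_cat_simps Hom_ordinal_cat\<close>)
  then show ?thesis
    by (simp add: nerve_def cat_functor_restrict_fun restrict_fun_idem)
qed

lemma restrict_ordinal_simps:
  "i \<le> n \<Longrightarrow> FOb (restrict_fun (ordinal_cat n) F) i = FOb F i"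
  "\<lbrakk>i \<le> j; j \<le> n\<rbrakk> \<Longrightarrow> FAr (restrict_fun (ordinal_cat n) F) (i, j) = FAr F (i, j)"
  by (simp_all add: restrict_fun_def ordinal_cat_simps)

lemma
  assumes "\<sigma> \<in> Smp (nerve C) n"
  shows nerve_ob: "i \<le> n \<Longrightarrow> FOb \<sigma> i \<in> Ob C"
    and nerve_ar: "\<lbrakk>i \<le> j; j \<le> n\<rbrakk> \<Longrightarrow> FAr \<sigma> (i, j) \<in> Hom C (FOb \<sigma> i) (FOb \<sigma> j)"
    and nerve_ide: "i \<le> n \<Longrightarrow> FAr \<sigma> (i, i) = Ide C (FOb \<sigma> i)"
    and nerve_comp: "\<lbrakk>i \<le> j; j \<le> k; k \<le> n\<rbrakk>
      \<Longrightarrow> FAr \<sigma> (i, k) = Comp C (FAr \<sigma> (j, k)) (FAr \<sigma> (i, j))"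
proof -
  interpret cat_functor "ordinal_cat n" C \<sigma>
    using assms by (simp add: nerve_def)
  show "i \<le> n \<Longrightarrow> FOb \<sigma> i \<in> Ob C"
    using ob_in by (simp add: ordinal_cat_simps)
  show "\<lbrakk>i \<le> j; j \<le> n\<rbrakk> \<Longrightarrow> FAr \<sigma> (i, j) \<in> Hom C (FOb \<sigma> i) (FOb \<sigma> j)"
    using ar_in by (simp add: Hom_ordinal_cat)
  show "i \<le> n \<Longrightarrow> FAr \<sigma> (i, i) = Ide C (FOb \<sigma> i)"
    using map_ide[of i] by (simp add: ordinal_cat_simps)
  show "\<lbrakk>i \<le> j; j \<le> k; k \<le> n\<rbrakk> \<Longrightarrow> FAr \<sigma> (i, k) = Comp C (FAr \<sigma> (j, k)) (FAr \<sigma> (i, j))"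
    using map_comp[of "(i, j)" i j "(j, k)" k] by (simp add: ordinal_cat_simps Hom_ordinal_cat)
qed

lemma nerve_simplex_eqI:
  assumes \<sigma>: "\<sigma> \<in> Smp (nerve C) n" and \<tau>: "\<tau> \<in> Smp (nerve C) n"
    and ob: "\<And>i. i \<le> n \<Longrightarrow> FOb \<sigma> i = FOb \<tau> i"
    and ar: "\<And>i j. \<lbrakk>i \<le> j; j \<le> n\<rbrakk> \<Longrightarrow> FAr \<sigma> (i, j) = FAr \<tau> (i, j)"
  shows "\<sigma> = \<tau>"
proof -
  have "restrict_fun (ordinal_cat n) \<sigma> = restrict_fun (ordinal_cat n) \<tau>"
    using ob ar by (auto simp: restrict_fun_def ordinal_cat_simps fun_eq_iff restrict_def)
  then show ?thesis
    using \<sigma> \<tau> by (simp add: nerve_def)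
qed

lemma nerve_act_simps:
  "i \<le> m \<Longrightarrow> FOb (Act (nerve C) m n \<theta> \<sigma>) i = FOb \<sigma> (\<theta> i)"
  "\<lbrakk>i \<le> j; j \<le> m\<rbrakk> \<Longrightarrow> FAr (Act (nerve C) m n \<theta> \<sigma>) (i, j) = FAr \<sigma> (\<theta> i, \<theta> j)"
  by (simp_all add: nerve_def restrict_ordinal_simps comp_fun_def ordinal_functor_def)

definition vertex :: "('o, 'm) cat \<Rightarrow> 'o \<Rightarrow> ('o, 'm) nerve_simplex" where
  "vertex C x = restrict_fun (ordinal_cat 0) \<lparr>FOb = \<lambda>_. x, FAr = \<lambda>(_, _). Ide C x\<rparr>"

lemma (in category) vertex_in: "x \<in> Ob C \<Longrightarrow> vertex C x \<in> Smp (nerve C) 0"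
  unfolding vertex_def
  by (intro nerve_simplexI category_axioms) (use ide_in comp_ide_left in force)+

lemma vertex_ob: "FOb (vertex C x) 0 = x"
  by (simp add: vertex_def restrict_ordinal_simps)

lemma connected_space_open_complement_empty:
  "\<lbrakk>connected_space X; openin X S; openin X T; topspace X \<subseteq> S \<union> T; S \<inter> T = {}; S \<noteq> {}\<rbrakk> \<Longrightarrow> T = {}"
  unfolding connected_space_def by blast

text \<open>The component containing the first vertex of a simplex is invariant under the operators,
  because a simplex contains an arrow from its vertex 0 to each of its vertices. Lying or not lying
  in the component of \<open>x\<close> thus defines two disjoint open sets covering the realization,
  and an object outside that component would give a point of the second.\<close>

lemma (in category) connected_of_path_connected_nerve:
  assumes pc: "path_connected_space (realization (nerve C))" and ne: "topspace (realization (nerve C)) \<noteq> {}"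
  shows "\<exists>x\<in>Ob C. \<forall>y\<in>Ob C. (x, y) \<in> conn_rel C"
proof -
  interpret N: simplicial_set "nerve C"
    by (rule simplicial_set_nerve)
  obtain n \<sigma> t where \<sigma>: "\<sigma> \<in> Smp (nerve C) n" and t: "t \<in> standard_simplex n"
    using ne by (auto simp: topspace_realization topspace_prerealization)
  define x where "x = FOb \<sigma> 0"
  define Q where "Q = (\<lambda>(n :: nat) (\<tau> :: ('o, 'm) nerve_simplex). (x, FOb \<tau> 0) \<in> conn_rel C)"
  let ?V = "\<lambda>Q. {(n, \<tau>, t). \<tau> \<in> Smp (nerve C) n \<and> t \<in> standard_simplex n \<and> Q n \<tau>}"
  have x: "x \<in> Ob C"
    using nerve_ob[OF \<sigma>, of 0] by (simp add: x_def)
  have step: "(x, y) \<in> conn_rel C \<longleftrightarrow> (x, z) \<in> conn_rel C" if h: "h \<in> Hom C y z" for y z h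
  proof -
    have "equivclp (\<lambda>x y. Hom C x y \<noteq> {}) y z"
      using h by (intro r_into_equivclp) blast
    then have "equivclp (\<lambda>x y. Hom C x y \<noteq> {}) x y \<longleftrightarrow> equivclp (\<lambda>x y. Hom C x y \<noteq> {}) x z"
      by (rule equivclp_cong_right)
    then show ?thesis
      using Hom_ob[OF h] x by (simp add: conn_rel_def)
  qed
  have Q_act: "Q m (Act (nerve C) m n \<theta> \<tau>) \<longleftrightarrow> Q n \<tau>"
    if \<theta>: "\<theta> \<in> mono_maps m n" and \<tau>: "\<tau> \<in> Smp (nerve C) n" for m n \<theta> \<tau>
  proof -
    have "\<theta> 0 \<le> n"
      using \<theta> by (auto simp: mono_maps_def)
    then have "FAr \<tau> (0, \<theta> 0) \<in> Hom C (FOb \<tau> 0) (FOb \<tau> (\<theta> 0))"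
      using nerve_ar[OF \<tau>] by simp
    then show ?thesis
      using step by (auto simp: Q_def nerve_act_simps)
  qed
  have Q_glue: "Q (fst p) (fst (snd p)) \<longleftrightarrow> Q (fst q) (fst (snd q))" if "equivclp (glue (nerve C)) p q" for p q
    using that by (rule equivclp_invariant) (auto simp: glue_def Q_act)
  have "openin (realization (nerve C)) (glue_class (nerve C) ` ?V Q)"
    using Q_act by (intro N.openin_realization_component) simp
  moreover have "openin (realization (nerve C)) (glue_class (nerve C) ` ?V (\<lambda>n \<tau>. \<not> Q n \<tau>))"
    using Q_act by (intro N.openin_realization_component) simp
  moreover have "topspace (realization (nerve C)) \<subseteq>
      glue_class (nerve C) ` ?V Q \<union> glue_class (nerve C) ` ?V (\<lambda>n \<tau>. \<not> Q n \<tau>)"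
    unfolding topspace_realization topspace_prerealization by blast
  moreover have "glue_class (nerve C) ` ?V Q \<inter> glue_class (nerve C) ` ?V (\<lambda>n \<tau>. \<not> Q n \<tau>) = {}"
  proof -
    have False if "p \<in> ?V Q" "q \<in> ?V (\<lambda>n \<tau>. \<not> Q n \<tau>)" "glue_class (nerve C) p = glue_class (nerve C) q" for p q
      using Q_glue[of p q] that unfolding glue_class_eq_iff by auto
    then show ?thesis
      by blast
  qed
  moreover have "glue_class (nerve C) ` ?V Q \<noteq> {}"
  proof -
    have "(n, \<sigma>, t) \<in> ?V Q"
      using \<sigma> t x by (auto simp: Q_def x_def conn_rel_def)
    then show ?thesis
      by blast
  qed
  ultimately have V: "glue_class (nerve C) ` ?V (\<lambda>n \<tau>. \<not> Q n \<tau>) = {}"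
    by (rule connected_space_open_complement_empty[OF path_connected_imp_connected_space[OF pc]])
  have "(x, y) \<in> conn_rel C" if y: "y \<in> Ob C" for y
  proof (rule ccontr)
    assume "(x, y) \<notin> conn_rel C"
    then have "(0, vertex C y, \<lambda>j. if j = 0 then 1 else 0) \<in> ?V (\<lambda>n \<tau>. \<not> Q n \<tau>)"
      using vertex_in[OF y] by (simp add: Q_def vertex_ob)
    then show False
      using V by blast
  qed
  then show ?thesis
    using x by blast
qed

section \<open>The realization of the terminal category, and comparison of the two asphericity
  conditions\<close>

lemma contractible_space_one_point:
  assumes "topspace X = {p}"
  shows "contractible_space X"
  unfolding contractible_space_def
  using assms by (intro exI[of _ p] homotopic_with_equal) auto

text \<open>Every simplex is pulled back from the only vertex along the map from \<open>[n]\<close>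
  to \<open>[0]\<close>, and that map sends the whole topological simplex to one point.\<close>

lemma topspace_realization_terminal: "\<exists>p. topspace (realization (nerve terminal_cat)) = {p}"
proof -
  interpret category terminal_cat
    by (rule category_terminal_cat)
  let ?N = "nerve terminal_cat" and ?e = "\<lambda>j. if j = 0 then 1 else 0"
  interpret N: simplicial_set ?N
    by (rule simplicial_set_nerve)
  have v: "vertex terminal_cat () \<in> Smp ?N 0"
    by (rule vertex_in) (simp add: terminal_cat_def)
  have eq: "glue_class ?N (n, \<sigma>, t) = glue_class ?N (0, vertex terminal_cat (), ?e)"
    if \<sigma>: "\<sigma> \<in> Smp ?N n" and t: "t \<in> standard_simplex n" for n \<sigma> t
  proof -
    define \<theta> where "\<theta> = restrict (\<lambda>_. 0::nat) {..n}"
    have \<theta>: "\<theta> \<in> mono_maps n 0"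
      by (auto simp: \<theta>_def mono_maps_def monotone_on_def)
    have "Act ?N n 0 \<theta> (vertex terminal_cat ()) = \<sigma>"
      by (rule nerve_simplex_eqI[OF N.act_in[OF \<theta> v] \<sigma>]) (rule old.unit.exhaust; simp)+
    moreover have "simplex_map n \<theta> t = ?e"
      using simplex_map_in[OF \<theta> t] by (simp add: standard_simplex_0)
    ultimately show ?thesis
      using glue_class_act[OF \<theta> v t] by simp
  qed
  have "topspace (realization ?N) = {glue_class ?N (0, vertex terminal_cat (), ?e)}"
  proof (rule subset_antisym; rule subsetI)
    fix K assume "K \<in> topspace (realization ?N)"
    then obtain n \<sigma> t where "\<sigma> \<in> Smp ?N n" "t \<in> standard_simplex n" "K = glue_class ?N (n, \<sigma>, t)"
      unfolding topspace_realization topspace_prerealization by blast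
    then show "K \<in> {glue_class ?N (0, vertex terminal_cat (), ?e)}"
      using eq by simp
  next
    have "(0, vertex terminal_cat (), ?e) \<in> topspace (prerealization ?N)"
      using v by (simp add: topspace_prerealization)
    then show "K \<in> topspace (realization ?N)" if "K \<in> {glue_class ?N (0, vertex terminal_cat (), ?e)}" for K
      using that unfolding topspace_realization by blast
  qed
  then show ?thesis ..
qed

text \<open>\<open>realization_map\<close> is a union of classes. Here every class in the union is
  the only point \<open>p\<close> and \<open>K\<close> is nonempty, so the union is \<open>p\<close>
  and the map is constant.\<close>

lemma (in category) continuous_map_realization_to_terminal:
  "continuous_map (realization (nerve C)) (realization (nerve terminal_cat))
    (realization_map (nerve terminal_cat) (nerve_map to_terminal))"
    (is "continuous_map ?X ?Y ?f")
proof -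
  interpret N: simplicial_set "nerve C"
    by (rule simplicial_set_nerve)
  obtain p where p: "topspace ?Y = {p}"
    using topspace_realization_terminal by blast
  have to_p: "?f K = p" if K: "K \<in> topspace ?X" for K
  proof -
    have "glue_class (nerve terminal_cat) (n, nerve_map to_terminal n \<sigma>, t) = p" if "(n, \<sigma>, t) \<in> K" for n \<sigma> t
    proof -
      have \<sigma>: "\<sigma> \<in> Smp (nerve C) n" and t: "t \<in> standard_simplex n"
        using N.glue_class_subset(1)[OF K] that by (auto simp: topspace_prerealization)
      have "cat_functor (ordinal_cat n) terminal_cat (to_terminal \<cdot>\<^sub>F \<sigma>)"
        by (rule cat_functor_comp_fun[OF _ cat_functor_to_terminal[OF category_axioms]])
          (use \<sigma> in \<open>simp add: nerve_def\<close>)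
      then have "nerve_map to_terminal n \<sigma> \<in> Smp (nerve terminal_cat) n"
        by (simp add: nerve_def nerve_map_def cat_functor_restrict_fun restrict_fun_idem)
      then have "(n, nerve_map to_terminal n \<sigma>, t) \<in> topspace (prerealization (nerve terminal_cat))"
        using t by (simp add: topspace_prerealization)
      then have "glue_class (nerve terminal_cat) (n, nerve_map to_terminal n \<sigma>, t) \<in> topspace ?Y"
        unfolding topspace_realization by (rule imageI)
      then show ?thesis
        by (simp add: p)
    qed
    then have "(\<lambda>(n, \<sigma>, t). glue_class (nerve terminal_cat) (n, nerve_map to_terminal n \<sigma>, t)) q = p"
      if "q \<in> K" for q
      using that by (cases q) simp
    then show ?thesis
      unfolding realization_map_def using N.glue_class_subset(2)[OF K] by simp
  qed
  have "continuous_map ?X ?Y (\<lambda>_. p)"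
    by (simp add: p)
  then show ?thesis
    by (rule continuous_map_eq) (simp only: to_p)
qed

text \<open>The bijection on path components gives the realization exactly one, so it is nonempty
  and path connected.\<close>

lemma (in category) W_zero_of_W_infinity:
  assumes "W_infinity C terminal_cat to_terminal"
  shows "W_zero C terminal_cat to_terminal"
proof -
  let ?X = "realization (nerve C)" and ?Y = "realization (nerve terminal_cat)"
  obtain p where p: "topspace ?Y = {p}"
    using topspace_realization_terminal by blast
  then have "path_components_of ?Y = {topspace ?Y}"
    using contractible_imp_path_connected_space[OF contractible_space_one_point[OF p]]
    by (simp add: path_components_of_eq_singleton)
  moreover have "\<exists>f. bij_betw f (path_components_of ?X) (path_components_of ?Y)"
    using assms by (auto simp: W_infinity_def simplicial_weak_equivalence_def weak_homotopy_equivalence_def)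
  ultimately have "card (path_components_of ?X) = 1"
    using bij_betw_same_card by fastforce
  then obtain K where "path_components_of ?X = {K}"
    using card_1_singletonE by blast
  then show ?thesis
    using connected_of_path_connected_nerve W_zero_terminal_iff[OF category_axioms]
    by (simp add: path_components_of_eq_singleton)
qed

section \<open>Categories with a terminal object\<close>

text \<open>
  Each simplex of the nerve is the face opposite to the last vertex \<open>e\<close> of its cone. Sliding
  towards that vertex is compatible with the gluing, because the cone is natural in the simplex,
  and hence contracts the realization.
\<close>

definition slide :: "real \<Rightarrow> nat \<Rightarrow> (nat \<Rightarrow> real) \<Rightarrow> nat \<Rightarrow> real" where
  "slide s n t = (\<lambda>i. if i = Suc n then s else (1 - s) * t i)"

text \<open>The join of \<theta> with the identity of the added vertex, restricted because
  \<open>mono_maps\<close> consists of extensional functions.\<close>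

definition cone_map :: "nat \<Rightarrow> nat \<Rightarrow> (nat \<Rightarrow> nat) \<Rightarrow> nat \<Rightarrow> nat" where
  "cone_map m n \<theta> = restrict (\<lambda>i. if i \<le> m then \<theta> i else Suc n) {..Suc m}"

lemma slide_in:
  assumes "0 \<le> s" "s \<le> 1" "t \<in> standard_simplex n"
  shows "slide s n t \<in> standard_simplex (Suc n)"
proof -
  have t: "0 \<le> t i" "t i \<le> 1" "(\<Sum>i\<le>n. t i) = 1" "i > n \<Longrightarrow> t i = 0" for i
    using assms(3) by (auto simp: standard_simplex_def)
  have "(\<Sum>i\<le>Suc n. slide s n t i) = (\<Sum>i\<le>n. (1 - s) * t i) + s"
    by (simp add: slide_def)
  also have "\<dots> = 1"
    using t(3) by (simp flip: sum_distrib_left)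
  finally show ?thesis
    using assms(1,2) t by (auto simp: standard_simplex_def slide_def mult_le_one)
qed

lemma cone_map_in:
  assumes "\<theta> \<in> mono_maps m n"
  shows "cone_map m n \<theta> \<in> mono_maps (Suc m) (Suc n)"
  using assms by (fastforce simp: mono_maps_def cone_map_def monotone_on_def le_Suc_eq)

text \<open>The added vertex is the only one over the added vertex, and all other fibres are those
  of \<theta>. This is the topological half of the naturality of the cone; \<open>cone_act\<close>
  is the simplicial half.\<close>

lemma simplex_map_slide:
  assumes \<theta>: "\<theta> \<in> mono_maps m n" and t: "t \<in> standard_simplex m"
  shows "simplex_map (Suc m) (cone_map m n \<theta>) (slide s m t) = slide s n (simplex_map m \<theta> t)"
proof
  fix i
  have \<theta>_le: "\<theta> j \<le> n" if "j \<le> m" for j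
    using \<theta> that by (auto simp: mono_maps_def)
  show "simplex_map (Suc m) (cone_map m n \<theta>) (slide s m t) i = slide s n (simplex_map m \<theta> t) i"
  proof (cases "i = Suc n")
    case True
    have "j \<le> Suc m \<and> cone_map m n \<theta> j = i \<longleftrightarrow> j = Suc m" for j
      using \<theta>_le[of j] True by (auto simp: cone_map_def)
    then have "{j. j \<le> Suc m \<and> cone_map m n \<theta> j = i} = {Suc m}"
      by simp
    then show ?thesis
      using True by (simp add: simplex_map_def slide_def)
  next
    case False
    have "{j. j \<le> Suc m \<and> cone_map m n \<theta> j = i} = {j. j \<le> m \<and> \<theta> j = i}"
      using False by (auto simp: cone_map_def)
    then show ?thesis
      using False by (auto simp: simplex_map_def slide_def sum_distrib_left intro!: sum.cong)
  qed
qed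

locale category_with_terminal = category C for C :: "('o, 'm) cat" +
  fixes e
  assumes terminal_in: "e \<in> Ob C" and terminal: "x \<in> Ob C \<Longrightarrow> \<exists>!f. f \<in> Hom C x e"
begin

definition bang where
  "bang x = (THE f. f \<in> Hom C x e)"

lemma bang_in: "x \<in> Ob C \<Longrightarrow> bang x \<in> Hom C x e"
  unfolding bang_def by (rule theI') (rule terminal)

lemma bang_unique: "f \<in> Hom C x e \<Longrightarrow> f = bang x"
  using terminal[of x] bang_in[of x] Hom_ob[of f x e] by blast

text \<open>The pair \<open>(Suc n, Suc n)\<close> is covered by the clause with
  \<open>bang\<close>, as \<open>bang e\<close> is the identity of \<open>e\<close>.\<close>

definition cone_simplex :: "nat \<Rightarrow> ('o, 'm) nerve_simplex \<Rightarrow> ('o, 'm) nerve_simplex" where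
  "cone_simplex n \<sigma> = restrict_fun (ordinal_cat (Suc n)) \<lparr>FOb = \<lambda>i. if i \<le> n then FOb \<sigma> i else e,
     FAr = \<lambda>(i, j). if j \<le> n then FAr \<sigma> (i, j) else bang (if i \<le> n then FOb \<sigma> i else e)\<rparr>"

lemma cone_in:
  assumes \<sigma>: "\<sigma> \<in> Smp (nerve C) n"
  shows "cone_simplex n \<sigma> \<in> Smp (nerve C) (Suc n)"
proof -
  let ?ob = "\<lambda>i. if i \<le> n then FOb \<sigma> i else e"
  let ?ar = "\<lambda>i j. if j \<le> n then FAr \<sigma> (i, j) else bang (?ob i)"
  have ob: "?ob i \<in> Ob C" for i
    using nerve_ob[OF \<sigma>] terminal_in by simp
  have ar: "?ar i j \<in> Hom C (?ob i) (?ob j)" if "i \<le> j" for i j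
    using nerve_ar[OF \<sigma> that] bang_in[OF ob[of i]] that by auto
  show ?thesis
    unfolding cone_simplex_def
  proof (rule nerve_simplexI[OF category_axioms ob ar])
    show "?ar i i = Ide C (?ob i)" for i
      using nerve_ide[OF \<sigma>] bang_unique[OF ide_in[OF terminal_in]] by simp
    show "?ar i k = Comp C (?ar j k) (?ar i j)" if "i \<le> j" "j \<le> k" for i j k
    proof (cases "k \<le> n")
      case True
      then show ?thesis
        using nerve_comp[OF \<sigma> that] that by simp
    next
      \<comment> \<open>Both sides are arrows into the terminal object.\<close>
      case False
      then show ?thesis
        using bang_unique comp_in[OF ar[OF that(1)] ar[OF that(2)]] by simp
    qed
  qed
qed

lemma cone_ob: "i \<le> Suc n \<Longrightarrow> FOb (cone_simplex n \<sigma>) i = (if i \<le> n then FOb \<sigma> i else e)"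
  by (simp add: cone_simplex_def restrict_ordinal_simps)

lemma cone_ar: "\<lbrakk>i \<le> j; j \<le> Suc n\<rbrakk> \<Longrightarrow>
    FAr (cone_simplex n \<sigma>) (i, j) = (if j \<le> n then FAr \<sigma> (i, j) else bang (if i \<le> n then FOb \<sigma> i else e))"
  by (simp add: cone_simplex_def restrict_ordinal_simps)

lemma cone_act:
  assumes \<theta>: "\<theta> \<in> mono_maps m n" and \<sigma>: "\<sigma> \<in> Smp (nerve C) n"
  shows "cone_simplex m (Act (nerve C) m n \<theta> \<sigma>) = Act (nerve C) (Suc m) (Suc n) (cone_map m n \<theta>) (cone_simplex n \<sigma>)"
proof -
  interpret N: simplicial_set "nerve C"
    by (rule simplicial_set_nerve)
  have \<theta>_le: "\<theta> j \<le> n" if "j \<le> m" for j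
    using \<theta> that by (auto simp: mono_maps_def)
  have mono: "\<theta> i \<le> \<theta> j" if "i \<le> j" "j \<le> m" for i j
    using \<theta> that by (simp add: mono_maps_def monotone_on_def)
  show ?thesis
  proof (rule nerve_simplex_eqI[OF cone_in[OF N.act_in[OF \<theta> \<sigma>]] N.act_in[OF cone_map_in[OF \<theta>] cone_in[OF \<sigma>]]])
    show "FOb (cone_simplex m (Act (nerve C) m n \<theta> \<sigma>)) i =
        FOb (Act (nerve C) (Suc m) (Suc n) (cone_map m n \<theta>) (cone_simplex n \<sigma>)) i" if "i \<le> Suc m" for i
      using that \<theta>_le[of i] by (simp add: nerve_act_simps cone_ob cone_map_def le_SucI)
    show "FAr (cone_simplex m (Act (nerve C) m n \<theta> \<sigma>)) (i, j) =
        FAr (Act (nerve C) (Suc m) (Suc n) (cone_map m n \<theta>) (cone_simplex n \<sigma>)) (i, j)"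
      if "i \<le> j" "j \<le> Suc m" for i j
      using that \<theta>_le[of i] \<theta>_le[of j] mono[of i j]
      by (simp add: nerve_act_simps cone_ar cone_map_def le_SucI)
  qed
qed

definition pre_cone where
  "pre_cone s = (\<lambda>(n, \<sigma>, t). (Suc n, cone_simplex n \<sigma>, slide s n t))"

lemma glue_pre_cone:
  assumes s: "0 \<le> s" "s \<le> 1" and "glue (nerve C) p q"
  shows "glue (nerve C) (pre_cone s p) (pre_cone s q)"
proof -
  obtain m n \<theta> \<sigma> t where \<theta>: "\<theta> \<in> mono_maps m n" and \<sigma>: "\<sigma> \<in> Smp (nerve C) n"
    and t: "t \<in> standard_simplex m"
    and p: "p = (m, Act (nerve C) m n \<theta> \<sigma>, t)" and q: "q = (n, \<sigma>, simplex_map m \<theta> t)"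
    using assms(3) by (auto simp: glue_def)
  have "pre_cone s p = (Suc m, Act (nerve C) (Suc m) (Suc n) (cone_map m n \<theta>) (cone_simplex n \<sigma>), slide s m t)"
    using cone_act[OF \<theta> \<sigma>] by (simp add: pre_cone_def p)
  moreover have "pre_cone s q = (Suc n, cone_simplex n \<sigma>, simplex_map (Suc m) (cone_map m n \<theta>) (slide s m t))"
    using simplex_map_slide[OF \<theta> t] by (simp add: pre_cone_def q)
  ultimately show ?thesis
    unfolding glue_def using cone_map_in[OF \<theta>] cone_in[OF \<sigma>] slide_in[OF s t] by blast
qed

lemma glue_class_pre_cone:
  assumes s: "0 \<le> s" "s \<le> 1" and "glue_class (nerve C) p = glue_class (nerve C) q"
  shows "glue_class (nerve C) (pre_cone s p) = glue_class (nerve C) (pre_cone s q)"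
proof -
  have "equivclp (glue (nerve C)) p q"
    using assms(3) by (simp add: glue_class_eq_iff)
  then show ?thesis
  proof (rule equivclp_invariant)
    fix p q assume "glue (nerve C) p q"
    then have "glue (nerve C) (pre_cone s p) (pre_cone s q)"
      by (rule glue_pre_cone[OF s])
    then show "glue_class (nerve C) (pre_cone s p) = glue_class (nerve C) (pre_cone s q)"
      unfolding glue_class_eq_iff by (rule r_into_equivclp)
  qed
qed

text \<open>At \<open>s = 0\<close> the added coordinate vanishes, so the point comes from the face
  opposite to the added vertex. Here \<theta> is the inclusion of that face, along which the cone
  restricts to \<sigma>.\<close>

lemma glue_class_pre_cone_0:
  assumes \<sigma>: "\<sigma> \<in> Smp (nerve C) n" and t: "t \<in> standard_simplex n"
  shows "glue_class (nerve C) (pre_cone 0 (n, \<sigma>, t)) = glue_class (nerve C) (n, \<sigma>, t)"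
proof -
  interpret N: simplicial_set "nerve C"
    by (rule simplicial_set_nerve)
  define \<theta> where "\<theta> = restrict id {..n}"
  have \<theta>: "\<theta> \<in> mono_maps n (Suc n)"
    by (auto simp: \<theta>_def mono_maps_def monotone_on_def)
  have "Act (nerve C) n (Suc n) \<theta> (cone_simplex n \<sigma>) = \<sigma>"
    by (rule nerve_simplex_eqI[OF N.act_in[OF \<theta> cone_in[OF \<sigma>]] \<sigma>])
      (simp_all add: nerve_act_simps \<theta>_def cone_ob cone_ar)
  moreover have "simplex_map n \<theta> t = slide 0 n t"
  proof
    fix i
    have "{j. j \<le> n \<and> \<theta> j = i} = (if i \<le> n then {i} else {})"
      by (auto simp: \<theta>_def)
    then show "simplex_map n \<theta> t i = slide 0 n t i"
      using t by (auto simp: simplex_map_def slide_def standard_simplex_def)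
  qed
  ultimately show ?thesis
    using glue_class_act[OF \<theta> cone_in[OF \<sigma>] t] by (simp add: pre_cone_def)
qed

text \<open>At \<open>s = 1\<close> all the weight sits on the added vertex. Here \<theta> picks
  that vertex, where the cone has the value \<open>e\<close> whatever \<sigma> is.\<close>

lemma glue_class_pre_cone_1:
  assumes \<sigma>: "\<sigma> \<in> Smp (nerve C) n" and t: "t \<in> standard_simplex n"
  shows "glue_class (nerve C) (pre_cone 1 (n, \<sigma>, t)) =
    glue_class (nerve C) (0, vertex C e, \<lambda>j. if j = 0 then 1 else 0)"
proof -
  interpret N: simplicial_set "nerve C"
    by (rule simplicial_set_nerve)
  let ?e = "(\<lambda>j. if j = 0 then 1 else 0) :: nat \<Rightarrow> real"
  define \<theta> where "\<theta> = restrict (\<lambda>_. Suc n) {..0 :: nat}"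
  have \<theta>: "\<theta> \<in> mono_maps 0 (Suc n)"
    by (auto simp: \<theta>_def mono_maps_def monotone_on_def)
  have "Act (nerve C) 0 (Suc n) \<theta> (cone_simplex n \<sigma>) = vertex C e"
    using bang_unique[OF ide_in[OF terminal_in]]
    by (intro nerve_simplex_eqI[OF N.act_in[OF \<theta> cone_in[OF \<sigma>]] vertex_in[OF terminal_in]])
      (simp_all add: nerve_act_simps \<theta>_def cone_ob cone_ar vertex_def restrict_ordinal_simps)
  moreover have "simplex_map 0 \<theta> ?e = slide 1 n t"
  proof
    fix i
    have "{j. j \<le> 0 \<and> \<theta> j = i} = (if i = Suc n then {0} else {})"
      by (auto simp: \<theta>_def)
    then show "simplex_map 0 \<theta> ?e i = slide 1 n t i"
      by (simp add: simplex_map_def slide_def)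
  qed
  moreover have "?e \<in> standard_simplex 0"
    by simp
  ultimately show ?thesis
    using glue_class_act[OF \<theta> cone_in[OF \<sigma>], of ?e] by (simp add: pre_cone_def)
qed

lemma continuous_map_pre_cone:
  "continuous_map (prod_topology (top_of_set {0..1}) (prerealization (nerve C))) (realization (nerve C))
    (\<lambda>(s, p). glue_class (nerve C) (pre_cone s p))"
  unfolding prerealization_def
proof (rule continuous_map_prod_sum_topology)
  fix n :: nat
  let ?I = "top_of_set {0..1::real}" and ?D = "\<lambda>n. discrete_topology (Smp (nerve C) n)"
  let ?\<Delta> = "\<lambda>n. subtopology (powertop_real UNIV) (standard_simplex n)"
  let ?P = "prod_topology ?I (prod_topology (?D n) (?\<Delta> n))"
  have "continuous_map ?P (?D (Suc n)) (\<lambda>q. cone_simplex n (fst (snd q)))"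
  proof -
    have "continuous_map (?D n) (?D (Suc n)) (cone_simplex n)"
      using cone_in by (simp add: Pi_iff)
    from continuous_map_compose[OF continuous_map_compose[OF continuous_map_snd continuous_map_fst] this]
    show ?thesis
      by (simp add: o_def)
  qed
  moreover have "continuous_map ?P (?\<Delta> (Suc n)) (\<lambda>q. slide (fst q) n (snd (snd q)))"
  proof -
    have "continuous_map ?P euclideanreal fst"
      using continuous_map_fst continuous_map_into_fulltopology by blast
    moreover have "continuous_map ?P euclideanreal (\<lambda>q. snd (snd q) i)" for i
    proof -
      have "continuous_map (?\<Delta> n) euclideanreal (\<lambda>t. t i)"
        by (intro continuous_map_from_subtopology continuous_map_product_projection) simp
      from continuous_map_compose[OF continuous_map_compose[OF continuous_map_snd continuous_map_snd] this]
      show ?thesis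
        by (simp add: o_def)
    qed
    ultimately have "continuous_map ?P euclideanreal (\<lambda>q. slide (fst q) n (snd (snd q)) i)" for i
      unfolding slide_def
      by (cases "i = Suc n") (simp_all add: continuous_map_real_mult continuous_map_diff)
    then show ?thesis
      using slide_in
      by (auto simp: continuous_map_in_subtopology continuous_map_componentwise_UNIV topspace_standard_simplex)
  qed
  ultimately have "continuous_map ?P (prod_topology (?D (Suc n)) (?\<Delta> (Suc n)))
      (\<lambda>q. (cone_simplex n (fst (snd q)), slide (fst q) n (snd (snd q))))"
    by (rule continuous_map_pairedI)
  moreover have "continuous_map (prod_topology (?D (Suc n)) (?\<Delta> (Suc n))) (prerealization (nerve C)) (Pair (Suc n))"
    unfolding prerealization_def
    using continuous_map_component_injection[of "Suc n" UNIV "\<lambda>n. prod_topology (?D n) (?\<Delta> n)"] by simp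
  ultimately have "continuous_map ?P (prerealization (nerve C))
      (Pair (Suc n) \<circ> (\<lambda>q. (cone_simplex n (fst (snd q)), slide (fst q) n (snd (snd q)))))"
    by (rule continuous_map_compose)
  from continuous_map_compose[OF this quotient_imp_continuous_map[OF quotient_map_realization]]
  show "continuous_map ?P (realization (nerve C))
      (\<lambda>(s, q). (\<lambda>(s, p). glue_class (nerve C) (pre_cone s p)) (s, n, q))"
    by (simp add: o_def pre_cone_def case_prod_unfold)
qed

lemma contractible_realization_nerve: "contractible_space (realization (nerve C))"
proof -
  let ?I = "top_of_set {0..1::real}" and ?R = "realization (nerve C)"
  let ?q = "\<lambda>(s :: real, p). (s, glue_class (nerve C) p)" and ?P = "prod_topology ?I (prerealization (nerve C))"
  let ?g = "\<lambda>(s, p). glue_class (nerve C) (pre_cone s p)"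
  \<comment> \<open>The product of a quotient map with a space need not be a quotient map; local
    compactness of the interval makes it one, so that the homotopy descends to the
    realization.\<close>
  have q: "quotient_map ?P (prod_topology ?I ?R) ?q"
  proof (rule quotient_map_prod_right[OF _ _ quotient_map_realization])
    show "locally_compact_space ?I"
      by (rule compact_imp_locally_compact_space) (simp add: compact_space_subtopology)
    show "Hausdorff_space ?I \<or> regular_space ?I"
      by (simp add: Hausdorff_space_subtopology)
  qed
  have "?g x = ?g y" if "x \<in> topspace ?P" "?q x = ?q y" for x y
    using that glue_class_pre_cone[of "fst x" "snd x" "snd y"] by (simp add: case_prod_unfold mem_Times_iff)
  then obtain h where h: "continuous_map (prod_topology ?I ?R) ?R h"
    and h_q: "\<And>x. x \<in> topspace ?P \<Longrightarrow> h (?q x) = ?g x"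
    using quotient_map_lift_exists[OF q continuous_map_pre_cone] by metis
  have h_eq: "h (s, glue_class (nerve C) p) = glue_class (nerve C) (pre_cone s p)"
    if "0 \<le> s" "s \<le> 1" "p \<in> topspace (prerealization (nerve C))" for s p
    using h_q[of "(s, p)"] that by simp
  have ends: "h (0, K) = K \<and> h (1, K) = glue_class (nerve C) (0, vertex C e, \<lambda>j. if j = 0 then 1 else 0)"
    if "K \<in> topspace ?R" for K
    using that h_eq[of 0] h_eq[of 1] glue_class_pre_cone_0 glue_class_pre_cone_1
    by (auto simp: topspace_realization topspace_prerealization)
  have "homotopic_with (\<lambda>_. True) ?R ?R id (\<lambda>_. glue_class (nerve C) (0, vertex C e, \<lambda>j. if j = 0 then 1 else 0))"
    using h ends by (subst homotopic_with) (simp, intro exI[of _ h], simp)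
  then show ?thesis
    unfolding contractible_space_def ..
qed

lemma W_infinity_to_terminal: "W_infinity C terminal_cat to_terminal"
proof -
  obtain p where p: "topspace (realization (nerve terminal_cat)) = {p}"
    using topspace_realization_terminal by blast
  have "(0, vertex C e, \<lambda>j. if j = 0 then 1 else 0) \<in> topspace (prerealization (nerve C))"
    using vertex_in[OF terminal_in] by (simp add: topspace_prerealization)
  then have "topspace (realization (nerve C)) \<noteq> {}"
    unfolding topspace_realization by blast
  then show ?thesis
    unfolding W_infinity_def simplicial_weak_equivalence_def
    using cat_functor_to_terminal[OF category_axioms] contractible_space_one_point[OF p]
      weak_homotopy_equivalence_contractible[OF contractible_realization_nerve _ _
        continuous_map_realization_to_terminal] by blast
qed

end

lemma (in category) W_infinity_of_has_terminal_object:
  assumes "has_terminal_object C"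
  shows "W_infinity C terminal_cat to_terminal"
proof -
  obtain e where "e \<in> Ob C" "\<And>x. x \<in> Ob C \<Longrightarrow> \<exists>!f. f \<in> Hom C x e"
    using assms by (auto simp only: has_terminal_object_def)
  then interpret category_with_terminal C e
    by unfold_locales
  show ?thesis
    by (rule W_infinity_to_terminal)
qed

section \<open>The circle of implications between the five conditions\<close>

theorem proposition2p17:
  fixes A :: "('a, 'am) cat" and B :: "('b, 'bm) cat"
    and A' :: "('c, 'cm) cat" and B' :: "('d, 'dm) cat"
    and v :: "('c, 'cm, 'a, 'am) cfun" and w :: "('d, 'dm, 'b, 'bm) cfun"
    and u' :: "('c, 'cm, 'd, 'dm) cfun" and u :: "('a, 'am, 'b, 'bm) cfun"
    and \<alpha> :: "'c \<Rightarrow> 'bm"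
  assumes "cat_square A B A' B' v w u' u \<alpha>"
    and "has_right_adjoint A B u"
    and "has_right_adjoint A' B' u'"
  shows "(left_beck_chevalley A B A' B' v w u' u \<alpha> \<longleftrightarrow>
            exact_square W_infinity A B A' B' v w u' u \<alpha>) \<and>
         (exact_square W_infinity A B A' B' v w u' u \<alpha> \<longleftrightarrow>
            exact_square W_zero A B A' B' v w u' u \<alpha>) \<and>
         (exact_square W_zero A B A' B' v w u' u \<alpha> \<longleftrightarrow>
            (\<forall>a\<in>Ob A. has_right_adjoint (under_cat A' A v a) (under_cat B' B w (FOb u a))
               (under_functor B u' u \<alpha>))) \<and>
         ((\<forall>a\<in>Ob A. has_right_adjoint (under_cat A' A v a) (under_cat B' B w (FOb u a))
               (under_functor B u' u \<alpha>)) \<longleftrightarrow>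
            (\<forall>a\<in>Ob A. \<forall>b'\<in>Ob B'. \<forall>g\<in>Hom B (FOb u a) (FOb w b').
               has_terminal_object (fibre_cat A B A' B' v w u' u \<alpha> a b' g)))"
proof -
  interpret cat_square A B A' B' v w u' u \<alpha>
    by fact
  let ?a = "left_beck_chevalley A B A' B' v w u' u \<alpha>"
  let ?b = "exact_square W_infinity A B A' B' v w u' u \<alpha>"
  let ?c = "exact_square W_zero A B A' B' v w u' u \<alpha>"
  let ?d = "\<forall>a\<in>Ob A. has_right_adjoint (under_cat A' A v a) (under_cat B' B w (FOb u a))
    (under_functor B u' u \<alpha>)"
  let ?e = "\<forall>a\<in>Ob A. \<forall>b'\<in>Ob B'. \<forall>g\<in>Hom B (FOb u a) (FOb w b'). has_terminal_object (fibre a b' g)"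
  have ae: ?e if a: ?a
  proof -
    obtain r \<eta> \<epsilon> r' \<eta>' \<epsilon>' where adj: "adjunction A B u r \<eta> \<epsilon>" "adjunction A' B' u' r' \<eta>' \<epsilon>'"
      and iso: "nat_iso B' A (v \<cdot>\<^sub>F r') (r \<cdot>\<^sub>F w) (base_change A v w \<alpha> r r' \<eta> \<epsilon>')"
      using a unfolding left_beck_chevalley_def by blast
    interpret adjoint_square A B A' B' v w u' u \<alpha> r \<eta> \<epsilon> r' \<eta>' \<epsilon>'
      using adj by (intro adjoint_square.intro adjoint_pair.intro cat_square_axioms)
    show ?e
      using lifts_singleton_of_iso[OF iso] has_terminal_object_fibre by metis
  qed
  have eb: ?b if ?e
    using that category.W_infinity_of_has_terminal_object[OF category_fibre_cat]
    by (simp add: exact_square_def aspherical_def)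
  have bc: ?c if ?b
    using that category.W_zero_of_W_infinity[OF category_fibre_cat]
    by (simp add: exact_square_def aspherical_def)
  have ca: ?a if ?c
  proof -
    \<comment> \<open>Condition (a) asks for some choice of adjunctions, and the assumed ones serve
      as witnesses.\<close>
    obtain r \<eta> \<epsilon> r' \<eta>' \<epsilon>' where adj: "adjunction A B u r \<eta> \<epsilon>" "adjunction A' B' u' r' \<eta>' \<epsilon>'"
      using assms(2,3) unfolding has_right_adjoint_def by blast
    interpret adjoint_square A B A' B' v w u' u \<alpha> r \<eta> \<epsilon> r' \<eta>' \<epsilon>'
      using adj by (intro adjoint_square.intro adjoint_pair.intro cat_square_axioms)
    have "nat_iso B' A (v \<cdot>\<^sub>F r') (r \<cdot>\<^sub>F w) c"
      using that by (intro nat_iso_base_change lifts_singleton_of_connected)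
        (simp_all add: exact_square_def aspherical_def)
    then show ?a
      using adj unfolding left_beck_chevalley_def by blast
  qed
  have de: "?d \<longleftrightarrow> ?e"
    using has_right_adjoint_under_functor_iff by (intro ball_cong refl)
  have "?a \<longleftrightarrow> ?b" "?b \<longleftrightarrow> ?c" "?c \<longleftrightarrow> ?d"
    using ae eb bc ca unfolding de by iprover+
  then show ?thesis
    using de by (intro conjI)
qed

end
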